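(* Let a functional $\varphi: G\to\mathbb{R}$ be $ci$-smooth of the order $\alpha$. Then, for any $(t,w(\cdot))\in G^0$, $x(\cdot)\in X(t,w(\cdot))$ and $\theta\in[t,T)$, the function $\omega(\tau)=\varphi(\tau,x_\tau(\cdot))$, $\tau\in[t,T]$, is continuous on $[t,T]$ and Lipschitz continuous on $[t,\theta]$. Moreover, $$\frac{d\omega(\tau)}{d\tau}=\partial_t^\alpha\varphi(\tau,x_\tau(\cdot))+\langle\nabla^\alpha\varphi(\tau,x_\tau(\cdot)),({}^CD^\alpha x)(\tau)\rangle\quad\text{for a.e. }\tau\in[t,\theta].$$
   Context: Fix $T>0$, $n \in \mathbb{N}$, $\alpha \in (0,1)$. $\|\cdot\|$ and $\langle\cdot,\cdot\rangle$ are the Euclidean norm and inner product in $\mathbb{R}^n$. Function spaces. For $t\in[0,T]$, $L^\infty([0,t],\mathbb{R}^n)$ is the set of measurable essentially bounded $\psi:[0,t]\to\mathbb{R}^n$. For $\beta\in(0,1)$, $(I^\beta\psi)(\tau)=\frac{1}{\Gamma(\beta)}\int_0^\tau \frac{\psi(\xi)}{(\tau-\xi)^{1-\beta}}d\xi$. $AC^\alpha([0,t],\mathbb{R}^n)$ is the set of functions $x:[0,t]\to\mathbb{R}^n$ of the form $x(\tau)=x(0)+(I^\alpha\psi)(\tau)$, $\tau\in[0,t]$, for some $\psi(\cdot)\in L^\infty([0,t],\mathbb{R}^n)$ (for $t=0$ it is identified with $\mathbb{R}^n$). For such $x(\cdot)$ the Caputo derivative $({}^CD^\alpha x)(\tau)=\frac{d}{d\tau}\big(I^{1-\alpha}(x(\cdot)-x(0))\big)(\tau)$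 exists for a.e. $\tau\in[0,t]$ and equals $\psi(\tau)$ a.e. Positions. $G$ is the set of pairs $(t,w(\cdot))$ with $t\in[0,T]$ and $w(\cdot)\in AC^\alpha([0,t],\mathbb{R}^n)$; $G^0=\{(t,w(\cdot))\in G: t<T\}$. $G$ (and its subset $G^0$) carries the metric $\operatorname{dist}((t,w),(t',w'))=\max\{\operatorname{dist}^*((t,w),(t',w')),\operatorname{dist}^*((t',w'),(t,w))\}$, where $\operatorname{dist}^*((t,w),(t',w'))=\max_{\tau\in[0,t]}\min_{\tau'\in[0,t']}(|\tau-\tau'|^2+\|w(\tau)-w'(\tau')\|^2)^{1/2}$. Coinvariant derivatives. For a function $x(\cdot)$ on $[0,T]$, $x_\tau(\cdot)$ denotes its restriction to $[0,\tau]$. For $(t,w(\cdot))\in G^0$, $X(t,w(\cdot))=\{x(\cdot)\in AC^\alpha([0,T],\mathbb{R}^n): x(\tau)=w(\tau),\ \tau\in[0,t]\}$. A functional $\varphi:G\to\mathbb{R}$ is $ci$-differentiable of the order $\alpha$ at $(t,w(\cdot))\in G^0$ if there exist $\partial_t^\alpha\varphi(t,w(\cdot))\in\mathbb{R}$ and $\nabla^\alpha\varphi(t,w(\cdot))\in\mathbb{R}^n$ such that for every $x(\cdot)\in X(t,w(\cdot))$ and $\tau\in(t,T)$ $$\varphi(\tau,x_\tau(\cdot))-\varphi(t,w(\cdot))=\partial_t^\alpha\varphi(t,w(\cdot))(\tau-t)+\Big\langle\nabla^\alpha\varphi(t,w(\cdot)),\big(I^{1-\alpha}(x(\cdot)-x(0))\big)(\tau)-\big(I^{1-\alpha}(w(\cdot)-w(0))\big)(t)\Big\rangle+o(\tau-t),$$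 where $o(\tau-t)$ may depend on $x(\cdot)$ and $o(\tau-t)/(\tau-t)\to0$ as $\tau\downarrow t$ (equivalently, the second entry of the inner product is $\int_t^\tau({}^CD^\alpha x)(\xi)d\xi$). These quantities are then unique. $\varphi$ is $ci$-smooth of the order $\alpha$ if $\varphi$ is continuous on $G$, is $ci$-differentiable of the order $\alpha$ at every point of $G^0$, and $\partial_t^\alpha\varphi:G^0\to\mathbb{R}$, $\nabla^\alpha\varphi:G^0\to\mathbb{R}^n$ are continuous (all with respect to $\operatorname{dist}$). *)

theory Defs
  imports "HOL-Analysis.Analysis" "HOL-Library.Landau_Symbols"
begin

text \<open>
  A function on \<open>[0, t]\<close> is a total function that is \<^const>\<open>undefined\<close> off \<open>{0..t}\<close>, so that
  equality of positions is equality of functions on \<open>[0, t]\<close>, and the restriction \<open>x\<^sub>\<tau>\<close> is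
  \<open>restrict x {0..\<tau>}\<close>.
\<close>

type_synonym 'n position = "real \<times> (real \<Rightarrow> real ^ 'n)"

definition ess_bounded :: "real \<Rightarrow> (real \<Rightarrow> real ^ 'n::finite) set" where
  "ess_bounded t = {\<psi>. \<psi> \<in> borel_measurable (lebesgue_on {0..t}) \<and>
     (\<exists>M. AE \<tau> in lebesgue_on {0..t}. norm (\<psi> \<tau>) \<le> M)}"

definition frac_integral :: "real \<Rightarrow> (real \<Rightarrow> real ^ 'n::finite) \<Rightarrow> real \<Rightarrow> real ^ 'n" where
  "frac_integral \<beta> \<psi> \<tau> =
     (1 / Gamma \<beta>) *\<^sub>R (LINT \<xi>|lebesgue_on {0..\<tau>}. (1 / (\<tau> - \<xi>) powr (1 - \<beta>)) *\<^sub>R \<psi> \<xi>)"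

text \<open>For \<open>t = 0\<close> the condition below is void, so \<open>AC \<alpha> 0\<close> is a copy of the Euclidean space.\<close>

definition AC :: "real \<Rightarrow> real \<Rightarrow> (real \<Rightarrow> real ^ 'n::finite) set" where
  "AC \<alpha> t = {x \<in> extensional {0..t}.
     \<exists>\<psi> \<in> ess_bounded t. \<forall>\<tau>\<in>{0..t}. x \<tau> = x 0 + frac_integral \<alpha> \<psi> \<tau>}"

text \<open>
  The derivative exists only for almost every \<open>\<tau>\<close>; elsewhere \<^const>\<open>vector_derivative\<close>
  has an unspecified value.
\<close>

definition caputo_derivative :: "real \<Rightarrow> (real \<Rightarrow> real ^ 'n::finite) \<Rightarrow> real \<Rightarrow> real ^ 'n" where
  "caputo_derivative \<alpha> x \<tau> =
     vector_derivative (frac_integral (1 - \<alpha>) (\<lambda>\<xi>. x \<xi> - x 0)) (at \<tau>)"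

definition positions :: "real \<Rightarrow> real \<Rightarrow> 'n::finite position set" where
  "positions \<alpha> T = {(t, w). t \<in> {0..T} \<and> w \<in> AC \<alpha> t}"

definition positions0 :: "real \<Rightarrow> real \<Rightarrow> 'n::finite position set" where
  "positions0 \<alpha> T = {(t, w) \<in> positions \<alpha> T. t < T}"

text \<open>
  Supremum and infimum are attained for the (continuous) functions in \<^const>\<open>AC\<close>, so
  they are the maximum and minimum.
\<close>

definition semi_dist :: "'n::finite position \<Rightarrow> 'n position \<Rightarrow> real" where
  "semi_dist = (\<lambda>(t, w) (t', w').
     SUP \<tau>\<in>{0..t}. INF \<tau>'\<in>{0..t'}. sqrt (\<bar>\<tau> - \<tau>'\<bar>\<^sup>2 + (norm (w \<tau> - w' \<tau>'))\<^sup>2))"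

definition pos_dist :: "'n::finite position \<Rightarrow> 'n position \<Rightarrow> real" where
  "pos_dist p q = max (semi_dist p q) (semi_dist q p)"

definition pos_continuous_on ::
    "'n::finite position set \<Rightarrow> ('n position \<Rightarrow> 'b::metric_space) \<Rightarrow> bool" where
  "pos_continuous_on S f \<longleftrightarrow>
     (\<forall>p\<in>S. \<forall>e>0. \<exists>d>0. \<forall>q\<in>S. pos_dist q p < d \<longrightarrow> dist (f q) (f p) < e)"

definition extensions ::
    "real \<Rightarrow> real \<Rightarrow> 'n::finite position \<Rightarrow> (real \<Rightarrow> real ^ 'n::finite) set" where
  "extensions \<alpha> T = (\<lambda>(t, w). {x \<in> AC \<alpha> T. \<forall>\<tau>\<in>{0..t}. x \<tau> = w \<tau>})"

text \<open>
  The filter \<^term>\<open>at_right t\<close> may be used for \<open>\<tau> \<in> (t, T)\<close>, as \<open>t < T\<close> for the positions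
  at which differentiability is considered.
\<close>

definition has_ci_derivative ::
    "real \<Rightarrow> real \<Rightarrow> ('n::finite position \<Rightarrow> real) \<Rightarrow> 'n position \<Rightarrow> real \<times> (real ^ 'n) \<Rightarrow> bool"
where
  "has_ci_derivative \<alpha> T \<phi> = (\<lambda>(t, w) (a, v). \<forall>x \<in> extensions \<alpha> T (t, w).
     (\<lambda>\<tau>. \<phi> (\<tau>, restrict x {0..\<tau>}) - \<phi> (t, w) - a * (\<tau> - t)
        - v \<bullet> (frac_integral (1 - \<alpha>) (\<lambda>\<xi>. x \<xi> - x 0) \<tau>
                - frac_integral (1 - \<alpha>) (\<lambda>\<xi>. w \<xi> - w 0) t))
     \<in> o[at_right t](\<lambda>\<tau>. \<tau> - t))"

definition ci_differentiable ::
    "real \<Rightarrow> real \<Rightarrow> ('n::finite position \<Rightarrow> real) \<Rightarrow> 'n position \<Rightarrow> bool" where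
  "ci_differentiable \<alpha> T \<phi> p \<longleftrightarrow> (\<exists>d. has_ci_derivative \<alpha> T \<phi> p d)"

text \<open>The pair chosen is unique at every point of \<^const>\<open>positions0\<close> where it exists.\<close>

definition ci_derivative ::
    "real \<Rightarrow> real \<Rightarrow> ('n::finite position \<Rightarrow> real) \<Rightarrow> 'n position \<Rightarrow> real \<times> (real ^ 'n)" where
  "ci_derivative \<alpha> T \<phi> p = (SOME d. has_ci_derivative \<alpha> T \<phi> p d)"

definition ci_dt ::
    "real \<Rightarrow> real \<Rightarrow> ('n::finite position \<Rightarrow> real) \<Rightarrow> 'n position \<Rightarrow> real" where
  "ci_dt \<alpha> T \<phi> p = fst (ci_derivative \<alpha> T \<phi> p)"

definition ci_grad ::
    "real \<Rightarrow> real \<Rightarrow> ('n::finite position \<Rightarrow> real) \<Rightarrow> 'n position \<Rightarrow> real ^ 'n" where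
  "ci_grad \<alpha> T \<phi> p = snd (ci_derivative \<alpha> T \<phi> p)"

definition ci_smooth :: "real \<Rightarrow> real \<Rightarrow> ('n::finite position \<Rightarrow> real) \<Rightarrow> bool" where
  "ci_smooth \<alpha> T \<phi> \<longleftrightarrow>
     pos_continuous_on (positions \<alpha> T) \<phi> \<and>
     (\<forall>p \<in> positions0 \<alpha> T. ci_differentiable \<alpha> T \<phi> p) \<and>
     pos_continuous_on (positions0 \<alpha> T) (ci_dt \<alpha> T \<phi>) \<and>
     pos_continuous_on (positions0 \<alpha> T) (ci_grad \<alpha> T \<phi>)"

end

theory Submission imports Defs begin

text \<open>
  Write \<open>J = I\<^sup>1\<^sup>-\<^sup>\<alpha>(x - x(0))\<close>. As \<open>x - x(0) = I\<^sup>\<alpha>\<psi>\<close> with \<open>\<psi>\<close> essentially bounded, Fubini's theorem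
  and the Beta integral give \<open>J(\<tau>) = \<integral>\<^sub>0\<^sup>\<tau> \<psi>\<close>, so \<open>J\<close> is Lipschitz continuous and, by Lebesgue's
  theorem, differentiable almost everywhere. Differentiability of \<open>\<phi>\<close> only controls increments
  of \<open>\<omega>\<close> to the right of each point. Near a fixed \<open>\<tau>\<close>, however, the function
  \<open>g(s) = \<omega>(s) - a(\<tau>) s - \<langle>v(\<tau>), J(s)\<rangle>\<close>, with \<open>a\<close> and \<open>v\<close> the derivatives of \<open>\<phi>\<close> along \<open>x\<close>, has
  small right Dini derivatives at all points \<open>s\<close>, because \<open>a\<close> and \<open>v\<close> are continuous. A mean value
  inequality for Dini derivatives then bounds its increments on both sides, so \<open>\<omega>\<close> is
  differentiable wherever \<open>J\<close> is; no almost everywhere statement about \<open>\<omega>\<close> itself is needed.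
\<close>

section \<open>Lebesgue's differentiation theorem on the line\<close>

text \<open>
  Every exceptional point is an endpoint of arbitrarily short intervals over which the
  Riemann sum is off by a fixed proportion. Vitali's theorem extracts a disjoint subfamily
  covering almost all such points, and Henstock's lemma bounds its total length.
\<close>

lemma negligible_deviating_averages:
  fixes f :: "real \<Rightarrow> 'a::euclidean_space"
  assumes f: "f integrable_on {a..b}" and e: "e > 0"
  shows "negligible {x \<in> {a<..<b}. \<forall>d>0. \<exists>y\<in>{a..b}. y \<noteq> x \<and> \<bar>y - x\<bar> < d \<and>
    e * \<bar>y - x\<bar> < norm (\<bar>y - x\<bar> *\<^sub>R f x - integral {min x y..max x y} f)}"
    (is "negligible ?E")
  unfolding negligible_outer_le
proof (intro allI impI)
  fix \<epsilon> :: real assume "\<epsilon> > 0"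
  \<comment> \<open>Every chosen interval will deviate by more than \<open>e\<close> times its
    length, so a Henstock sum below \<open>e * \<epsilon>\<close> forces total length at most
    \<open>\<epsilon>\<close>.\<close>
  then have "e * \<epsilon> > 0" using e by simp
  then obtain \<gamma> where \<gamma>: "gauge \<gamma>"
    and H: "\<And>p. \<lbrakk>p tagged_partial_division_of (cbox a b); \<gamma> fine p\<rbrakk> \<Longrightarrow>
             (\<Sum>(x,k)\<in>p. norm (measure lborel k *\<^sub>R f x - integral k f)) < e * \<epsilon>"
    using Henstock_lemma[of f a b "e * \<epsilon>"] f unfolding interval_cbox by blast
  \<comment> \<open>An index \<open>(x, y)\<close> stands for the interval with tag \<open>x\<close>
    and other endpoint \<open>y\<close>; \<open>c\<close> and \<open>r\<close> are its midpoint and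
    half its length, as Vitali's theorem speaks of balls. \<open>K\<close> keeps the intervals that
    are fine for the gauge and deviate.\<close>
  define I where "I = (\<lambda>(x::real, y::real). {min x y..max x y})"
  define K where "K = {(x,y). x \<in> ?E \<and> y \<in> {a..b} \<and> y \<noteq> x \<and> I (x, y) \<subseteq> \<gamma> x \<and>
    e * \<bar>y - x\<bar> < norm (\<bar>y - x\<bar> *\<^sub>R f x - integral (I (x, y)) f)}"
  define c where "c = (\<lambda>(x::real, y::real). (x + y) / 2)"
  define r where "r = (\<lambda>(x::real, y::real). \<bar>y - x\<bar> / 2)"
  have cb: "cball (c p) (r p) = I p" for p
  proof -
    obtain x y where p: "p = (x, y)" by fastforce
    have "(x + y) / 2 - \<bar>y - x\<bar> / 2 = min x y" "(x + y) / 2 + \<bar>y - x\<bar> / 2 = max x y"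
      by (simp_all add: abs_if min_def max_def field_simps)
    then show ?thesis by (simp add: p c_def r_def I_def cball_eq_atLeastAtMost)
  qed
  have content_I: "measure lborel (I p) = \<bar>snd p - fst p\<bar>" for p
    by (auto simp: I_def split: prod.splits)
  obtain C where C: "countable C" "C \<subseteq> K"
     "pairwise (\<lambda>i j. disjnt (I i) (I j)) C"
     "negligible (?E - (\<Union>i \<in> C. I i))"
  proof (rule Vitali_covering_theorem_cballs[of K r ?E c])
    fix i assume "i \<in> K" then show "0 < r i" by (auto simp: K_def r_def)
  next
    fix x d :: real assume x: "x \<in> ?E" and d: "0 < d"
    obtain \<delta> where \<delta>: "\<delta> > 0" "ball x \<delta> \<subseteq> \<gamma> x"
      using \<gamma> unfolding gauge_def by (meson open_contains_ball)
    have "min d \<delta> > 0" using d \<delta> by simp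
    with x obtain y where y: "y \<in> {a..b}" "y \<noteq> x" "\<bar>y - x\<bar> < min d \<delta>"
      "e * \<bar>y - x\<bar> < norm (\<bar>y - x\<bar> *\<^sub>R f x - integral {min x y..max x y} f)" by blast
    have "I (x, y) \<subseteq> ball x \<delta>"
      using y(3) by (auto simp: I_def dist_real_def)
    with \<delta>(2) have "I (x, y) \<subseteq> \<gamma> x" by (rule order_trans[rotated])
    with x y have "(x, y) \<in> K" by (simp add: K_def I_def)
    then show "\<exists>i. i \<in> K \<and> x \<in> cball (c i) (r i) \<and> r i < d"
      unfolding cb using y by (intro exI[of _ "(x, y)"]) (auto simp: r_def I_def)
  qed (auto simp: cb)
  \<comment> \<open>Henstock's lemma concerns finite partial divisions; a uniform bound for finite
    subfamilies then passes to the countable union.\<close>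
  have bd: "measure lebesgue (\<Union>i\<in>D. I i) \<le> \<epsilon>" if D: "D \<subseteq> C" "finite D" for D
  proof -
    define p where "p = (\<lambda>i. (fst i, I i)) ` D"
    \<comment> \<open>Each interval contains its own tag, so indices with equal images have
      intersecting intervals and must coincide by disjointness.\<close>
    have inj: "inj_on (\<lambda>i. (fst i, I i)) D"
    proof (rule inj_onI)
      fix i j assume "i \<in> D" "j \<in> D" "(fst i, I i) = (fst j, I j)"
      moreover have "fst i \<in> I i" by (auto simp: I_def split: prod.splits)
      ultimately have "i \<in> C" "j \<in> C" "\<not> disjnt (I i) (I j)"
        using D(1) by (auto simp: disjnt_def)
      then show "i = j" using C(3) unfolding pairwise_def by blast
    qed
    have "p tagged_partial_division_of (cbox a b)"
      unfolding tagged_partial_division_of_def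
    proof (intro conjI allI impI; (elim conjE)?)
      show "finite p" using D by (simp add: p_def)
    next
      fix x k assume "(x, k) \<in> p"
      then obtain i where i: "i \<in> D" "x = fst i" "k = I i" by (auto simp: p_def)
      then have "i \<in> K" using D C by blast
      show "x \<in> k" using i by (auto simp: I_def split: prod.splits)
      show "k \<subseteq> cbox a b" using i \<open>i \<in> K\<close> by (auto simp: I_def K_def split: prod.splits)
      show "\<exists>a b. k = cbox a b" using i by (auto simp: I_def split: prod.splits intro: exI)
    next
      fix x k x' k' assume "(x, k) \<in> p" "(x', k') \<in> p" "(x, k) \<noteq> (x', k')"
      then obtain i j where ij: "i \<in> D" "k = I i" "j \<in> D" "k' = I j" "i \<noteq> j"
        by (auto simp: p_def)
      then have "disjnt (I i) (I j)" using C(3) D unfolding pairwise_def by blast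
      then show "interior k \<inter> interior k' = {}" using ij interior_subset unfolding disjnt_def by blast
    qed
    moreover have "\<gamma> fine p"
    proof (rule fineI)
      fix x k assume "(x, k) \<in> p"
      then obtain i where i: "i \<in> D" "x = fst i" "k = I i" by (auto simp: p_def)
      then have "i \<in> K" using D C by blast
      then show "k \<subseteq> \<gamma> x" using i by (simp add: K_def split_beta)
    qed
    ultimately have *: "(\<Sum>(x,k)\<in>p. norm (measure lborel k *\<^sub>R f x - integral k f)) < e * \<epsilon>" by (rule H)
    have "e * (\<Sum>i\<in>D. measure lborel (I i)) \<le> (\<Sum>i\<in>D. norm (measure lborel (I i) *\<^sub>R f (fst i) - integral (I i) f))"
      unfolding sum_distrib_left
    proof (rule sum_mono)
      fix i assume "i \<in> D"
      then have "i \<in> K" using D C by blast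
      then show "e * measure lborel (I i) \<le> norm (measure lborel (I i) *\<^sub>R f (fst i) - integral (I i) f)"
        unfolding content_I by (auto simp: K_def)
    qed
    also have "\<dots> = (\<Sum>(x,k)\<in>p. norm (measure lborel k *\<^sub>R f x - integral k f))"
      unfolding p_def sum.reindex[OF inj] by simp
    finally have "e * (\<Sum>i\<in>D. measure lborel (I i)) \<le> e * \<epsilon>" using * by linarith
    then have "(\<Sum>i\<in>D. measure lborel (I i)) \<le> \<epsilon>" using e by simp
    moreover have "measure lebesgue (\<Union>i\<in>D. I i) \<le> (\<Sum>i\<in>D. measure lebesgue (I i))"
      using D by (intro measure_UNION_le) (auto simp: I_def split: prod.splits)
    ultimately show ?thesis by (simp add: measure_completion I_def split_def)
  qed
  have I_meas: "I i \<in> lmeasurable" for i by (auto simp: I_def split: prod.splits)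
  \<comment> \<open>The cover consists of the null set that Vitali's theorem leaves over and the
    chosen intervals themselves.\<close>
  define T where "T = (?E - (\<Union>i \<in> C. I i)) \<union> (\<Union>i\<in>C. I i)"
  have U: "(\<Union>i\<in>C. I i) \<in> lmeasurable" "measure lebesgue (\<Union>i\<in>C. I i) \<le> \<epsilon>"
    using fmeasurable_UN_bound[OF C(1) I_meas bd] measure_UN_bound[OF C(1) I_meas bd] by auto
  have N: "?E - (\<Union>i \<in> C. I i) \<in> lmeasurable" "measure lebesgue (?E - (\<Union>i \<in> C. I i)) = 0"
    using C(4) negligible_imp_measurable negligible_imp_measure0 by blast+
  have "measure lebesgue T \<le> measure lebesgue (?E - (\<Union>i \<in> C. I i)) + measure lebesgue (\<Union>i\<in>C. I i)"
    unfolding T_def using N U by (intro measure_Un_le) auto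
  then have "measure lebesgue T \<le> \<epsilon>" using N U by linarith
  moreover have "T \<in> lmeasurable" using N U unfolding T_def by blast
  moreover have "?E \<subseteq> T" by (auto simp: T_def)
  ultimately show "\<exists>T. ?E \<subseteq> T \<and> T \<in> lmeasurable \<and> measure lebesgue T \<le> \<epsilon>" by blast
qed

text \<open>Outside the countably many null sets belonging to \<open>e = 1 / (n + 1)\<close>, the
  averages of \<open>f\<close> over intervals ending at \<open>x\<close> converge to
  \<open>f x\<close> from both sides.\<close>

lemma negligible_not_has_vector_derivative_integral:
  fixes f :: "real \<Rightarrow> 'a::euclidean_space"
  assumes f: "f integrable_on {a..b}"
  shows "negligible {x \<in> {a<..<b}. \<not> ((\<lambda>u. integral {a..u} f) has_vector_derivative f x) (at x)}"
proof -
  define E where "E = (\<lambda>n::nat. {x \<in> {a<..<b}. \<forall>d>0. \<exists>y\<in>{a..b}. y \<noteq> x \<and> \<bar>y - x\<bar> < d \<and>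
    inverse (Suc n) * \<bar>y - x\<bar> < norm (\<bar>y - x\<bar> *\<^sub>R f x - integral {min x y..max x y} f)})"
  have "negligible (\<Union>n. E n)"
    unfolding E_def by (intro negligible_Union_nat negligible_deviating_averages f) auto
  moreover have "((\<lambda>u. integral {a..u} f) has_vector_derivative f x) (at x)"
    if x: "x \<in> {a<..<b}" "x \<notin> (\<Union>n. E n)" for x
    unfolding has_vector_derivative_def has_derivative_at_alt
  proof (intro conjI allI impI)
    fix e :: real assume "0 < e"
    then obtain n where n: "inverse (real (Suc n)) < e" using reals_Archimedean by blast
    from x have "x \<notin> E n" by blast
    then have "\<exists>d>0. \<forall>y\<in>{a..b}. y \<noteq> x \<and> \<bar>y - x\<bar> < d \<longrightarrow>
       \<not> inverse (Suc n) * \<bar>y - x\<bar> < norm (\<bar>y - x\<bar> *\<^sub>R f x - integral {min x y..max x y} f)"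
      using x(1) unfolding E_def mem_Collect_eq by meson
    then obtain d where d: "d > 0" and dd: "\<And>y. \<lbrakk>y \<in> {a..b}; y \<noteq> x; \<bar>y - x\<bar> < d\<rbrakk> \<Longrightarrow>
       norm (\<bar>y - x\<bar> *\<^sub>R f x - integral {min x y..max x y} f) \<le> inverse (Suc n) * \<bar>y - x\<bar>"
      by (meson not_le_imp_less)
    \<comment> \<open>The distances to \<open>a\<close> and \<open>b\<close> keep \<open>y\<close>
      inside \<open>{a..b}\<close>.\<close>
    define d' where "d' = min d (min (x - a) (b - x))"
    have "d' > 0" using d x by (auto simp: d'_def)
    moreover have "norm (integral {a..y} f - integral {a..x} f - (y - x) *\<^sub>R f x) \<le> e * norm (y - x)"
      if y: "norm (y - x) < d'" for y
    proof (cases "y = x")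
      case False
      have yab: "y \<in> {a..b}" "\<bar>y - x\<bar> < d" using y by (auto simp: d'_def abs_if split: if_splits)
      have *: "integral {a..min x y} f + integral {min x y..max x y} f = integral {a..max x y} f"
        using yab x f by (intro Henstock_Kurzweil_Integration.integral_combine integrable_subinterval_real[OF f]) auto
      have "norm (integral {a..y} f - integral {a..x} f - (y - x) *\<^sub>R f x)
        = norm (\<bar>y - x\<bar> *\<^sub>R f x - integral {min x y..max x y} f)"
      proof (cases "x \<le> y")
        case True
        with * have "integral {a..y} f = integral {a..x} f + integral {x..y} f" by simp
        with True show ?thesis by (subst norm_minus_commute) (simp add: algebra_simps)
      next
        case False
        with * have "integral {a..x} f = integral {a..y} f + integral {y..x} f" by simp
        with False show ?thesis by (simp add: algebra_simps)
      qed
      also have "\<dots> \<le> inverse (Suc n) * \<bar>y - x\<bar>" using dd yab False by blast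
      also have "\<dots> \<le> e * norm (y - x)" using n by (simp add: mult_right_mono)
      finally show ?thesis .
    qed auto
    ultimately show "\<exists>d>0. \<forall>y. norm (y - x) < d \<longrightarrow>
      norm (integral {a..y} f - integral {a..x} f - (y - x) *\<^sub>R f x) \<le> e * norm (y - x)" by blast
  qed (rule bounded_linear_scaleR_left)
  ultimately show ?thesis by (elim negligible_subset) blast
qed

section \<open>Increments bounded by right Dini derivatives\<close>

text \<open>For a slightly larger slope, the points satisfying the bound form a closed set, which
  contains its supremum. The Dini condition there would yield a larger such point unless the
  supremum is \<open>b\<close>.\<close>

lemma dini_increment_bound:
  fixes f :: "real \<Rightarrow> 'a::real_normed_vector"
  assumes ab: "a \<le> b" and cont: "continuous_on {a..b} f"
    and dini: "\<And>s e. \<lbrakk>s \<in> {a..<b}; e > 0\<rbrakk> \<Longrightarrow>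
      \<forall>\<^sub>F r in at_right s. norm (f r - f s) \<le> (C + e) * (r - s)"
  shows "norm (f b - f a) \<le> C * (b - a)"
proof (rule field_le_epsilon)
  fix e :: real assume e: "e > 0"
  \<comment> \<open>The summand 1 keeps the denominator positive when \<open>a = b\<close>.\<close>
  define e' where "e' = e / (b - a + 1)"
  have e': "e' > 0" "e' * (b - a) \<le> e"
    using e ab by (auto simp: e'_def field_simps)
  define S where "S = {s \<in> {a..b}. norm (f s - f a) \<le> (C + e') * (s - a)}"
  define m where "m = Sup S"
  have S_ne: "a \<in> S" using ab by (simp add: S_def)
  have S_bdd: "bdd_above S" by (auto simp: S_def intro: bdd_aboveI[of _ b])
  have "closed S"
    unfolding S_def using cont by (intro continuous_on_closed_Collect_le continuous_intros) auto
  then have m: "m \<in> S" using closed_contains_Sup[of S] S_ne S_bdd unfolding m_def by blast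
  have "m = b"
  proof (rule ccontr)
    assume "m \<noteq> b"
    then have mb: "m \<in> {a..<b}" using m by (auto simp: S_def)
    have "\<forall>\<^sub>F r in at_right m. r \<in> {m<..<b}"
      using mb by (intro eventually_at_right_real) auto
    then have "\<forall>\<^sub>F r in at_right m. r \<in> {m<..<b} \<and> norm (f r - f m) \<le> (C + e') * (r - m)"
      using dini[OF mb e'(1)] by eventually_elim auto
    then obtain r where r: "r \<in> {m<..<b}" "norm (f r - f m) \<le> (C + e') * (r - m)"
      using eventually_happens'[OF trivial_limit_at_right_real] by blast
    have "norm (f r - f a) \<le> norm (f r - f m) + norm (f m - f a)"
      using norm_triangle_ineq[of "f r - f m" "f m - f a"] by simp
    also have "\<dots> \<le> (C + e') * (r - m) + (C + e') * (m - a)" using r m by (auto simp: S_def)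
    also have "\<dots> = (C + e') * (r - a)" by (simp add: algebra_simps)
    finally have "r \<in> S" using r mb by (auto simp: S_def)
    then have "r \<le> m" unfolding m_def using S_bdd by (rule cSup_upper)
    with r show False by simp
  qed
  with m have "norm (f b - f a) \<le> (C + e') * (b - a)" by (simp add: S_def)
  then show "norm (f b - f a) \<le> C * (b - a) + e" using e' by (simp add: algebra_simps)
qed

text \<open>With the coefficients frozen at \<open>A\<close> and \<open>V\<close>, the remainder
  \<open>g\<close> has right Dini derivatives of size at most
  \<open>\<epsilon> + \<epsilon> * M\<close>: one term from \<open>a s - A\<close>, the other from
  \<open>v s - V\<close> by Cauchy-Schwarz and the Lipschitz bound for \<open>J\<close>.\<close>

lemma chain_increment_bound:
  fixes \<omega> a :: "real \<Rightarrow> real" and v J :: "real \<Rightarrow> 'a::real_inner"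
  assumes pq: "p \<le> q" and \<omega>: "continuous_on {p..q} \<omega>"
    and J: "M-lipschitz_on {p..q} J"
    and incr: "\<And>s e. \<lbrakk>s \<in> {p..<q}; e > 0\<rbrakk> \<Longrightarrow> \<forall>\<^sub>F r in at_right s.
      \<bar>\<omega> r - \<omega> s - a s * (r - s) - v s \<bullet> (J r - J s)\<bar> \<le> e * (r - s)"
    and a: "\<And>s. s \<in> {p..<q} \<Longrightarrow> \<bar>a s - A\<bar> \<le> \<epsilon>"
    and v: "\<And>s. s \<in> {p..<q} \<Longrightarrow> norm (v s - V) \<le> \<epsilon>"
  shows "\<bar>\<omega> q - \<omega> p - A * (q - p) - V \<bullet> (J q - J p)\<bar> \<le> \<epsilon> * (1 + M) * (q - p)"
proof -
  define g where "g = (\<lambda>\<tau>. \<omega> \<tau> - A * \<tau> - V \<bullet> J \<tau>)"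
  have "norm (g q - g p) \<le> \<epsilon> * (1 + M) * (q - p)"
  proof (rule dini_increment_bound[OF pq])
    show "continuous_on {p..q} g"
      unfolding g_def using \<omega> lipschitz_on_continuous_on[OF J] by (intro continuous_intros)
  next
    fix s e :: real assume s: "s \<in> {p..<q}" and e: "e > 0"
    have "\<forall>\<^sub>F r in at_right s. r \<in> {s<..<q}"
      using s by (intro eventually_at_right_real) auto
    then show "\<forall>\<^sub>F r in at_right s. norm (g r - g s) \<le> (\<epsilon> * (1 + M) + e) * (r - s)"
      using incr[OF s e]
    proof eventually_elim
      case (elim r)
      have "\<bar>(a s - A) * (r - s)\<bar> \<le> \<epsilon> * (r - s)"
        using a[OF s] elim by (simp add: abs_mult mult_right_mono)
      moreover have "\<bar>(v s - V) \<bullet> (J r - J s)\<bar> \<le> \<epsilon> * (M * (r - s))"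
      proof -
        have "\<bar>(v s - V) \<bullet> (J r - J s)\<bar> \<le> norm (v s - V) * norm (J r - J s)"
          by (rule Cauchy_Schwarz_ineq2)
        also have "norm (J r - J s) \<le> M * (r - s)"
          using lipschitz_onD[OF J, of r s] s elim by (simp add: dist_norm)
        then have "norm (v s - V) * norm (J r - J s) \<le> \<epsilon> * (M * (r - s))"
          using v[OF s] order_trans[OF norm_ge_zero v[OF s]] by (intro mult_mono) auto
        finally show ?thesis .
      qed
      moreover have "g r - g s = (\<omega> r - \<omega> s - a s * (r - s) - v s \<bullet> (J r - J s))
          + (a s - A) * (r - s) + (v s - V) \<bullet> (J r - J s)"
        by (simp add: g_def algebra_simps inner_diff_right inner_diff_left)
      ultimately have "norm (g r - g s) \<le> e * (r - s) + \<epsilon> * (r - s) + \<epsilon> * (M * (r - s))"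
        using elim(2) unfolding real_norm_def by linarith
      then show ?case by (simp add: algebra_simps)
    qed
  qed
  moreover have "g q - g p = \<omega> q - \<omega> p - A * (q - p) - V \<bullet> (J q - J p)"
    by (simp add: g_def right_diff_distrib inner_diff_right)
  ultimately show ?thesis by simp
qed

text \<open>The increment bound is applied with \<open>A = 0\<close> and \<open>V = 0\<close>;
  \<open>\<epsilon>\<close> is then a common bound for \<open>a\<close> and \<open>v\<close> on the
  compact interval.\<close>

lemma chain_lipschitz_on:
  fixes \<omega> a :: "real \<Rightarrow> real" and v J :: "real \<Rightarrow> 'a::real_inner"
  assumes \<omega>: "continuous_on {t..\<theta>} \<omega>"
    and J: "M-lipschitz_on {t..\<theta>} J"
    and incr: "\<And>s e. \<lbrakk>s \<in> {t..\<theta>}; e > 0\<rbrakk> \<Longrightarrow> \<forall>\<^sub>F r in at_right s.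
      \<bar>\<omega> r - \<omega> s - a s * (r - s) - v s \<bullet> (J r - J s)\<bar> \<le> e * (r - s)"
    and a: "continuous_on {t..\<theta>} a" and v: "continuous_on {t..\<theta>} v"
  shows "\<exists>L. L-lipschitz_on {t..\<theta>} \<omega>"
proof -
  have "bounded (a ` {t..\<theta>})" "bounded (v ` {t..\<theta>})"
    using a v by (auto intro!: compact_imp_bounded compact_continuous_image)
  then obtain Ba Bv where "\<forall>y\<in>a ` {t..\<theta>}. norm y \<le> Ba" "\<forall>y\<in>v ` {t..\<theta>}. norm y \<le> Bv"
    unfolding bounded_iff by blast
  then have B: "\<bar>a s\<bar> \<le> Ba" "norm (v s) \<le> Bv" if "s \<in> {t..\<theta>}" for s
    using that by auto
  \<comment> \<open>The maximum with 0 makes the Lipschitz constant nonnegative even if the interval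
    is empty.\<close>
  define \<epsilon> where "\<epsilon> = max 0 (max Ba Bv)"
  have M: "0 \<le> M" using J by (rule lipschitz_on_nonneg)
  have *: "\<bar>\<omega> q - \<omega> p\<bar> \<le> \<epsilon> * (1 + M) * (q - p)" if "p \<in> {t..\<theta>}" "q \<in> {t..\<theta>}" "p \<le> q" for p q
  proof -
    have "\<bar>\<omega> q - \<omega> p - 0 * (q - p) - 0 \<bullet> (J q - J p)\<bar> \<le> \<epsilon> * (1 + M) * (q - p)"
    proof (rule chain_increment_bound[OF that(3)])
      show "continuous_on {p..q} \<omega>" using that by (auto intro: continuous_on_subset[OF \<omega>])
      show "M-lipschitz_on {p..q} J" using that by (auto intro: lipschitz_on_subset[OF J])
      fix s assume s: "s \<in> {p..<q}"
      then show "\<bar>a s - 0\<bar> \<le> \<epsilon>" "norm (v s - 0) \<le> \<epsilon>"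
        using B[of s] that by (auto simp: \<epsilon>_def)
      show "\<forall>\<^sub>F r in at_right s. \<bar>\<omega> r - \<omega> s - a s * (r - s) - v s \<bullet> (J r - J s)\<bar> \<le> e * (r - s)"
        if "e > 0" for e using s \<open>p \<in> _\<close> \<open>q \<in> _\<close> that by (intro incr) auto
    qed
    then show ?thesis by simp
  qed
  have "(\<epsilon> * (1 + M))-lipschitz_on {t..\<theta>} \<omega>"
  proof (rule lipschitz_onI)
    show "0 \<le> \<epsilon> * (1 + M)" using M by (simp add: \<epsilon>_def)
    fix x y assume "x \<in> {t..\<theta>}" "y \<in> {t..\<theta>}"
    then show "dist (\<omega> x) (\<omega> y) \<le> \<epsilon> * (1 + M) * dist x y"
      using *[of x y] *[of y x] by (cases "x \<le> y") (auto simp: dist_real_def abs_minus_commute)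
  qed
  then show ?thesis by blast
qed

lemma chain_has_real_derivative:
  fixes \<omega> a :: "real \<Rightarrow> real" and v J :: "real \<Rightarrow> 'a::real_inner"
  assumes \<omega>: "continuous_on {t<..<T} \<omega>"
    and J: "M-lipschitz_on {t<..<T} J"
    and incr: "\<And>s e. \<lbrakk>s \<in> {t<..<T}; e > 0\<rbrakk> \<Longrightarrow> \<forall>\<^sub>F r in at_right s.
      \<bar>\<omega> r - \<omega> s - a s * (r - s) - v s \<bullet> (J r - J s)\<bar> \<le> e * (r - s)"
    and a: "continuous_on {t<..<T} a" and v: "continuous_on {t<..<T} v"
    and \<tau>: "\<tau> \<in> {t<..<T}" and J': "(J has_vector_derivative D) (at \<tau>)"
  shows "(\<omega> has_real_derivative a \<tau> + v \<tau> \<bullet> D) (at \<tau>)"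
proof -
  define A V where "A = a \<tau>" and "V = v \<tau>"
  define g where "g = (\<lambda>s. \<omega> s - A * s - V \<bullet> J s)"
  have M: "0 \<le> M" using J by (rule lipschitz_on_nonneg)
  have "(g has_derivative (\<lambda>_. 0)) (at \<tau>)"
    unfolding has_derivative_at_alt
  proof (intro conjI allI impI)
    fix e :: real assume e: "e > 0"
    define \<epsilon> where "\<epsilon> = e / (1 + M)"
    have \<epsilon>: "\<epsilon> > 0" "\<epsilon> * (1 + M) = e" using e M by (auto simp: \<epsilon>_def)
    have "(a \<longlongrightarrow> A) (nhds \<tau>)" "(v \<longlongrightarrow> V) (nhds \<tau>)"
      using a v \<tau> unfolding A_def V_def
      by (auto simp: continuous_on_eq_continuous_at isCont_def tendsto_at_iff_tendsto_nhds)
    then have "\<forall>\<^sub>F s in nhds \<tau>. dist (a s) A < \<epsilon> \<and> dist (v s) V < \<epsilon> \<and> s \<in> {t<..<T}"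
      using \<epsilon>(1) \<tau> by (intro eventually_conj tendstoD eventually_nhds_in_open) auto
    then obtain d where "d > 0" and d: "\<And>s. dist s \<tau> < d \<Longrightarrow> dist (a s) A < \<epsilon> \<and> dist (v s) V < \<epsilon> \<and> s \<in> {t<..<T}"
      unfolding eventually_nhds_metric by blast
    \<comment> \<open>The passage from right increments to a two-sided derivative: \<open>p\<close>
      and \<open>q\<close> are arbitrary near \<open>\<tau>\<close>, so \<open>\<tau>\<close> may
      serve as the left or as the right endpoint.\<close>
    have bd: "\<bar>g q - g p\<bar> \<le> e * (q - p)"
      if pq: "\<bar>p - \<tau>\<bar> < d" "\<bar>q - \<tau>\<bar> < d" "p \<le> q" for p q
    proof -
      have sub: "s \<in> {t<..<T} \<and> \<bar>s - \<tau>\<bar> < d" if "s \<in> {p..q}" for s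
        using that pq d[of s] by (auto simp: dist_real_def)
      have "\<bar>\<omega> q - \<omega> p - A * (q - p) - V \<bullet> (J q - J p)\<bar> \<le> \<epsilon> * (1 + M) * (q - p)"
      proof (rule chain_increment_bound[OF pq(3)])
        show "continuous_on {p..q} \<omega>" using sub by (auto intro: continuous_on_subset[OF \<omega>])
        show "M-lipschitz_on {p..q} J" using sub by (blast intro: lipschitz_on_subset[OF J])
        fix s assume s: "s \<in> {p..<q}"
        then have "\<bar>s - \<tau>\<bar> < d" using sub by simp
        then show "\<bar>a s - A\<bar> \<le> \<epsilon>" "norm (v s - V) \<le> \<epsilon>"
          using d[of s] by (auto simp: dist_norm)
        show "\<forall>\<^sub>F r in at_right s. \<bar>\<omega> r - \<omega> s - a s * (r - s) - v s \<bullet> (J r - J s)\<bar> \<le> e * (r - s)"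
          if "e > 0" for e using s sub[of s] that by (intro incr) auto
      qed
      moreover have "g q - g p = \<omega> q - \<omega> p - A * (q - p) - V \<bullet> (J q - J p)"
        by (simp add: g_def right_diff_distrib inner_diff_right)
      ultimately show ?thesis by (simp only: \<epsilon>(2))
    qed
    have "norm (g y - g \<tau> - 0) \<le> e * norm (y - \<tau>)" if "norm (y - \<tau>) < d" for y
      using bd[of y \<tau>] bd[of \<tau> y] that \<open>d > 0\<close>
      by (cases "y \<le> \<tau>") (auto simp: abs_minus_commute)
    with \<open>d > 0\<close> show "\<exists>d>0. \<forall>y. norm (y - \<tau>) < d \<longrightarrow> norm (g y - g \<tau> - 0) \<le> e * norm (y - \<tau>)"
      by blast
  qed (rule bounded_linear_zero)
  then have "(g has_real_derivative 0) (at \<tau>)"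
    by (simp add: has_field_derivative_def lambda_zero)
  moreover have "((\<lambda>s. V \<bullet> J s) has_real_derivative V \<bullet> D) (at \<tau>)"
    unfolding has_real_derivative_iff_has_vector_derivative
    by (rule bounded_linear.has_vector_derivative[OF bounded_linear_inner_right J'])
  ultimately have "((\<lambda>s. g s + A * s + V \<bullet> J s) has_real_derivative 0 + A * 1 + V \<bullet> D) (at \<tau>)"
    by (intro DERIV_add DERIV_cmult DERIV_ident)
  then show ?thesis by (simp add: g_def A_def V_def)
qed

section \<open>Kernels of fractional integration\<close>

text \<open>The antiderivative is continuous up to \<open>c\<close> because \<open>\<beta>\<close>
  is positive. The interior form of the fundamental theorem thus covers \<open>b = c\<close>, where
  the kernel may be singular.\<close>

lemma has_integral_powr_kernel:
  assumes "0 < (\<beta>::real)" "a \<le> b" "b \<le> c"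
  shows "((\<lambda>\<xi>. (c - \<xi>) powr (\<beta> - 1)) has_integral ((c - a) powr \<beta> - (c - b) powr \<beta>) / \<beta>) {a..b}"
proof -
  have "((\<lambda>\<xi>. (c - \<xi>) powr (\<beta> - 1)) has_integral (- ((c - b) powr \<beta> / \<beta>) - - ((c - a) powr \<beta> / \<beta>))) {a..b}"
  proof (rule fundamental_theorem_of_calculus_interior)
    show "continuous_on {a..b} (\<lambda>x. - ((c - x) powr \<beta> / \<beta>))"
      using assms by (intro continuous_intros continuous_on_powr') auto
    fix x assume "x \<in> {a<..<b}"
    then show "((\<lambda>x. - ((c - x) powr \<beta> / \<beta>)) has_vector_derivative (c - x) powr (\<beta> - 1)) (at x)"
      unfolding has_real_derivative_iff_has_vector_derivative[symmetric]
      using assms by (auto intro!: derivative_eq_intros simp: powr_diff field_simps)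
  qed (use assms in auto)
  then show ?thesis by (simp add: diff_divide_distrib)
qed

text \<open>The substitution \<open>t = (\<eta> - x) / (s - x)\<close> leads to the Beta integral
  over the unit interval.\<close>

lemma has_integral_Beta_kernel:
  assumes ab: "0 < (a::real)" "0 < b" and x: "x < s"
  shows "((\<lambda>\<eta>. (s - \<eta>) powr (b - 1) * (\<eta> - x) powr (a - 1))
    has_integral Beta a b * (s - x) powr (a + b - 1)) {x..s}"
proof -
  define h where "h = s - x"
  have h: "h > 0" using x by (simp add: h_def)
  have "((\<lambda>t. (t powr (a - 1) * (1 - t) powr (b - 1))) has_integral Beta a b) (cbox 0 1)"
    using has_integral_Beta_real[OF ab] by simp
  from has_integral_affinity'[OF this, of "1 / h" "- x / h"] h
  have *: "((\<lambda>u. (1 / h * u + - x / h) powr (a - 1) * (1 - (1 / h * u + - x / h)) powr (b - 1)) has_integral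
    Beta a b /\<^sub>R (1 / h) ^ DIM(real)) (cbox ((0 - - x / h) /\<^sub>R (1 / h)) ((1 - - x / h) /\<^sub>R (1 / h)))"
    by simp
  have "((\<lambda>\<eta>. ((\<eta> - x) / h) powr (a - 1) * (1 - (\<eta> - x) / h) powr (b - 1)) has_integral Beta a b * h) {x..s}"
  proof -
    have ends: "(0 - - x / h) /\<^sub>R (1 / h) = x" "(1 - - x / h) /\<^sub>R (1 / h) = s"
      using h by (simp_all add: h_def field_simps)
    have aff: "1 / h * u + - x / h = (u - x) / h" for u by (simp add: diff_divide_distrib)
    show ?thesis using *[unfolded ends aff] by (simp add: mult.commute)
  qed
  \<comment> \<open>The factor undoes the scaling of the two powers, with exponents
    \<open>a - 1\<close> and \<open>b - 1\<close>; one further \<open>h\<close> comes from the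
    substitution.\<close>
  from has_integral_mult_right[OF this, of "h powr (a + b - 2)"]
  have "((\<lambda>\<eta>. h powr (a + b - 2) * (((\<eta> - x) / h) powr (a - 1) * (1 - (\<eta> - x) / h) powr (b - 1)))
    has_integral h powr (a + b - 2) * (Beta a b * h)) {x..s}" .
  also have "h powr (a + b - 2) * (Beta a b * h) = Beta a b * h powr (a + b - 1)"
  proof -
    have "h powr (a + b - 2) * h = h powr (a + b - 2) * h powr 1" using h by simp
    also have "\<dots> = h powr (a + b - 1)" unfolding powr_add[symmetric] by simp
    finally show ?thesis by simp
  qed
  finally have *: "((\<lambda>\<eta>. h powr (a + b - 2) * (((\<eta> - x) / h) powr (a - 1) * (1 - (\<eta> - x) / h) powr (b - 1)))
    has_integral Beta a b * h powr (a + b - 1)) {x..s}" .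
  show ?thesis
  proof (rule has_integral_eq[OF _ *[unfolded h_def]])
    fix \<eta> assume \<eta>: "\<eta> \<in> {x..s}"
    have "1 - (\<eta> - x) / h = (s - \<eta>) / h" using h by (simp add: field_simps h_def)
    moreover have "h powr (a + b - 2) = h powr (a - 1) * h powr (b - 1)"
      unfolding powr_add[symmetric] by simp
    ultimately show "(s - x) powr (a + b - 2) * (((\<eta> - x) / (s - x)) powr (a - 1) * (1 - (\<eta> - x) / (s - x)) powr (b - 1)) =
      (s - \<eta>) powr (b - 1) * (\<eta> - x) powr (a - 1)"
      using \<eta> h unfolding h_def[symmetric] by (simp add: powr_divide)
  qed
qed

text \<open>The kernels are evaluated as gauge integrals, while Fubini's theorem needs Bochner
  integrals. Nonnegativity allows the passage through the nonnegative Lebesgue integral.\<close>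

lemma has_bochner_integral_lborel_nonneg:
  fixes f :: "real \<Rightarrow> real"
  assumes "(f has_integral I) S" "f \<in> borel_measurable borel" "S \<in> sets borel" "\<And>x. x \<in> S \<Longrightarrow> 0 \<le> f x"
  shows "has_bochner_integral lborel (\<lambda>x. indicator S x * f x) I"
proof (rule has_bochner_integral_nn_integral)
  show "(\<lambda>x. indicator S x * f x) \<in> borel_measurable lborel" using assms by measurable
  show "AE x in lborel. 0 \<le> indicator S x * f x" using assms by (auto simp: indicator_def)
  show "0 \<le> I" using assms has_integral_nonneg by blast
  show "(\<integral>\<^sup>+ x. ennreal (indicator S x * f x) \<partial>lborel) = ennreal I"
    by (rule nn_integral_has_integral_lebesgue[OF assms(4,1)])
qed

lemma has_bochner_integral_powr_kernel:
  assumes "0 < (\<beta>::real)" "a \<le> b" "b \<le> c"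
  shows "has_bochner_integral lborel (\<lambda>\<xi>. indicator {a..b} \<xi> * (c - \<xi>) powr (\<beta> - 1))
    (((c - a) powr \<beta> - (c - b) powr \<beta>) / \<beta>)"
  by (rule has_bochner_integral_lborel_nonneg[OF has_integral_powr_kernel[OF assms]]) auto

lemma has_bochner_integral_Beta_kernel:
  assumes "0 < (a::real)" "0 < b" "x < s"
  shows "has_bochner_integral lborel
    (\<lambda>\<eta>. indicator {x..s} \<eta> * ((s - \<eta>) powr (b - 1) * (\<eta> - x) powr (a - 1)))
    (Beta a b * (s - x) powr (a + b - 1))"
  by (rule has_bochner_integral_lborel_nonneg[OF has_integral_Beta_kernel[OF assms]]) auto

text \<open>After Fubini's theorem the inner integral over \<open>\<eta>\<close> is a Beta integral
  with exponents adding up to 1, so its value \<open>Beta \<alpha> (1 - \<alpha>)\<close> does not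
  depend on \<open>\<xi>\<close>.\<close>

lemma fractional_kernel_complement:
  fixes g :: "real \<Rightarrow> 'a::{banach, second_countable_topology}"
  assumes \<alpha>: "0 < \<alpha>" "\<alpha> < 1" and g [measurable]: "g \<in> borel_measurable borel"
    and M: "\<And>x. norm (g x) \<le> M"
  shows "(\<integral>\<eta>. (indicator {0..s} \<eta> * (s - \<eta>) powr (- \<alpha>)) *\<^sub>R
           (\<integral>\<xi>. (indicator {0..\<eta>} \<xi> * (\<eta> - \<xi>) powr (\<alpha> - 1)) *\<^sub>R g \<xi> \<partial>lborel) \<partial>lborel)
    = Beta \<alpha> (1 - \<alpha>) *\<^sub>R (\<integral>\<xi>. indicator {0..s} \<xi> *\<^sub>R g \<xi> \<partial>lborel)"
    (is "?L = ?R")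
proof -
  \<comment> \<open>Both kernels and both ranges of integration are merged into one function on the
    triangle \<open>0 \<le> \<xi> \<le> \<eta> \<le> s\<close>, which makes joint measurability
    immediate.\<close>
  define k where "k = (\<lambda>\<xi> \<eta>::real. if 0 \<le> \<xi> \<and> \<xi> \<le> \<eta> \<and> \<eta> \<le> s
    then (s - \<eta>) powr (- \<alpha>) * (\<eta> - \<xi>) powr (\<alpha> - 1) else 0)"
  have k_meas [measurable]: "case_prod k \<in> borel_measurable (lborel \<Otimes>\<^sub>M lborel)"
    unfolding k_def by measurable
  have k_nonneg: "k \<xi> \<eta> \<ge> 0" for \<xi> \<eta> by (simp add: k_def)
  \<comment> \<open>For \<open>\<xi> = s \<ge> 0\<close> the triangle degenerates to a point and the
    integral is 0 instead; one point is a null set.\<close>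
  have k_int: "has_bochner_integral lborel (k \<xi>) (indicator {0..s} \<xi> * Beta \<alpha> (1 - \<alpha>))"
    if "\<xi> \<noteq> s" for \<xi>
  proof (cases "\<xi> \<in> {0..s}")
    case True
    then have "has_bochner_integral lborel (\<lambda>\<eta>. indicator {\<xi>..s} \<eta> * ((s - \<eta>) powr (1 - \<alpha> - 1) * (\<eta> - \<xi>) powr (\<alpha> - 1)))
      (Beta \<alpha> (1 - \<alpha>) * (s - \<xi>) powr (\<alpha> + (1 - \<alpha>) - 1))"
      using that \<alpha> by (intro has_bochner_integral_Beta_kernel) auto
    also have "(\<lambda>\<eta>. indicator {\<xi>..s} \<eta> * ((s - \<eta>) powr (1 - \<alpha> - 1) * (\<eta> - \<xi>) powr (\<alpha> - 1))) = k \<xi>"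
      using True by (auto simp: k_def indicator_def fun_eq_iff)
    also have "Beta \<alpha> (1 - \<alpha>) * (s - \<xi>) powr (\<alpha> + (1 - \<alpha>) - 1) = indicator {0..s} \<xi> * Beta \<alpha> (1 - \<alpha>)"
      using that True by simp
    finally show ?thesis .
  next
    case False
    then have "k \<xi> = (\<lambda>_. 0)" by (auto simp: k_def fun_eq_iff)
    then show ?thesis using False by (simp add: has_bochner_integral_zero)
  qed
  have ae: "AE \<xi> in lborel. \<xi> \<noteq> s" by (rule AE_lborel_singleton)
  have int: "integrable (lborel \<Otimes>\<^sub>M lborel) (\<lambda>(\<xi>, \<eta>). k \<xi> \<eta> *\<^sub>R g \<xi>)"
  proof (rule lborel_pair.Fubini_integrable)
    show "(\<lambda>(\<xi>, \<eta>). k \<xi> \<eta> *\<^sub>R g \<xi>) \<in> borel_measurable (lborel \<Otimes>\<^sub>M lborel)" by measurable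
    have i: "integrable lborel (\<lambda>\<xi>. indicator {0..s} \<xi> *\<^sub>R (Beta \<alpha> (1 - \<alpha>) * norm (g \<xi>)))"
    proof (rule integrableI_bounded_set_indicator[where B="\<bar>Beta \<alpha> (1 - \<alpha>)\<bar> * M"])
      show "AE x in lborel. x \<in> {0..s} \<longrightarrow> norm (Beta \<alpha> (1 - \<alpha>) * norm (g x)) \<le> \<bar>Beta \<alpha> (1 - \<alpha>)\<bar> * M"
        using M by (auto simp: abs_mult intro!: mult_left_mono)
    qed (auto simp: emeasure_lborel_Icc_eq)
    have eq: "AE \<xi> in lborel. indicator {0..s} \<xi> *\<^sub>R (Beta \<alpha> (1 - \<alpha>) * norm (g \<xi>)) =
      (\<integral>\<eta>. norm (case (\<xi>, \<eta>) of (\<xi>, \<eta>) \<Rightarrow> k \<xi> \<eta> *\<^sub>R g \<xi>) \<partial>lborel)"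
      using ae
    proof eventually_elim
      case (elim \<xi>)
      have "(\<integral>\<eta>. norm (case (\<xi>, \<eta>) of (\<xi>, \<eta>) \<Rightarrow> k \<xi> \<eta> *\<^sub>R g \<xi>) \<partial>lborel) = (\<integral>\<eta>. k \<xi> \<eta> * norm (g \<xi>) \<partial>lborel)"
        using k_nonneg by simp
      also have "\<dots> = indicator {0..s} \<xi> * Beta \<alpha> (1 - \<alpha>) * norm (g \<xi>)"
        using k_int[OF elim] by (simp add: has_bochner_integral_iff)
      finally show ?case by (simp only: real_scaleR_def mult.assoc)
    qed
    show "integrable lborel (\<lambda>\<xi>. \<integral>\<eta>. norm (case (\<xi>, \<eta>) of (\<xi>, \<eta>) \<Rightarrow> k \<xi> \<eta> *\<^sub>R g \<xi>) \<partial>lborel)"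
      by (rule Bochner_Integration.integrable_cong_AE_imp[OF i _ eq]) measurable
    show "AE \<xi> in lborel. integrable lborel (\<lambda>\<eta>. case (\<xi>, \<eta>) of (\<xi>, \<eta>) \<Rightarrow> k \<xi> \<eta> *\<^sub>R g \<xi>)"
      using ae
    proof eventually_elim
      case (elim \<xi>)
      then show ?case using k_int[OF elim] by (simp add: has_bochner_integral_iff)
    qed
  qed
  have "?L = (\<integral>\<eta>. (\<integral>\<xi>. k \<xi> \<eta> *\<^sub>R g \<xi> \<partial>lborel) \<partial>lborel)"
  proof (rule Bochner_Integration.integral_cong[OF refl])
    fix \<eta> :: real
    have "(indicator {0..s} \<eta> * (s - \<eta>) powr - \<alpha>) *\<^sub>R
           (\<integral>\<xi>. (indicator {0..\<eta>} \<xi> * (\<eta> - \<xi>) powr (\<alpha> - 1)) *\<^sub>R g \<xi> \<partial>lborel)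
      = (\<integral>\<xi>. (indicator {0..s} \<eta> * (s - \<eta>) powr - \<alpha>) *\<^sub>R ((indicator {0..\<eta>} \<xi> * (\<eta> - \<xi>) powr (\<alpha> - 1)) *\<^sub>R g \<xi>) \<partial>lborel)"
      by (rule integral_scaleR_right[symmetric])
    also have "\<dots> = (\<integral>\<xi>. k \<xi> \<eta> *\<^sub>R g \<xi> \<partial>lborel)"
      by (rule Bochner_Integration.integral_cong) (auto simp: k_def indicator_def)
    finally show "(indicator {0..s} \<eta> * (s - \<eta>) powr - \<alpha>) *\<^sub>R
           (\<integral>\<xi>. (indicator {0..\<eta>} \<xi> * (\<eta> - \<xi>) powr (\<alpha> - 1)) *\<^sub>R g \<xi> \<partial>lborel)
      = (\<integral>\<xi>. k \<xi> \<eta> *\<^sub>R g \<xi> \<partial>lborel)" .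
  qed
  also have "\<dots> = (\<integral>\<xi>. (\<integral>\<eta>. k \<xi> \<eta> *\<^sub>R g \<xi> \<partial>lborel) \<partial>lborel)"
    by (rule lborel_pair.Fubini_integral[OF int])
  also have "\<dots> = (\<integral>\<xi>. Beta \<alpha> (1 - \<alpha>) *\<^sub>R (indicator {0..s} \<xi> *\<^sub>R g \<xi>) \<partial>lborel)"
  proof (rule integral_cong_AE)
    show "AE \<xi> in lborel. (\<integral>\<eta>. k \<xi> \<eta> *\<^sub>R g \<xi> \<partial>lborel) = Beta \<alpha> (1 - \<alpha>) *\<^sub>R (indicator {0..s} \<xi> *\<^sub>R g \<xi>)"
      using ae
    proof eventually_elim
      case (elim \<xi>)
      then show ?case using k_int[OF elim] by (simp add: has_bochner_integral_iff mult.commute)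
    qed
  qed measurable
  also have "\<dots> = ?R" by (rule integral_scaleR_right)
  finally show ?thesis .
qed

text \<open>The kernels for \<open>u\<close> and \<open>v\<close> differ in \<open>L1\<close> by at
  most \<open>2 / \<beta> * (v - u) powr \<beta>\<close>: one half comes from \<open>{0..u}\<close>,
  the other from \<open>{u..v}\<close>.\<close>

lemma powr_kernel_integral_bound:
  fixes g :: "real \<Rightarrow> 'a::{banach, second_countable_topology}"
  assumes \<beta>: "0 < \<beta>" "\<beta> < 1" and g [measurable]: "g \<in> borel_measurable borel"
    and M: "\<And>x. norm (g x) \<le> M" and u: "0 \<le> u" "u \<le> v"
  defines "F \<equiv> \<lambda>c. \<integral>\<xi>. (indicator {0..c} \<xi> * (c - \<xi>) powr (\<beta> - 1)) *\<^sub>R g \<xi> \<partial>lborel"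
  shows "norm (F v - F u) \<le> 2 * M / \<beta> * (v - u) powr \<beta>"
proof -
  define k where "k = (\<lambda>c \<xi>. indicator {0..c} \<xi> * (c - \<xi>) powr (\<beta> - 1))"
  have M0: "M \<ge> 0" using M[of 0] norm_ge_zero order_trans by blast
  have i1: "has_bochner_integral lborel (k c) (c powr \<beta> / \<beta>)" if "c \<ge> 0" for c
    using has_bochner_integral_powr_kernel[of \<beta> 0 c c] \<beta> that by (simp add: k_def)
  have [measurable]: "k c \<in> borel_measurable borel" for c unfolding k_def by measurable
  have ig: "integrable lborel (\<lambda>\<xi>. k c \<xi> *\<^sub>R g \<xi>)" if "c \<ge> 0" for c
  proof (rule Bochner_Integration.integrable_bound[where f="\<lambda>\<xi>. M * k c \<xi>"])
    show "integrable lborel (\<lambda>\<xi>. M * k c \<xi>)" using i1[OF that] by (simp add: has_bochner_integral_iff)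
    show "AE \<xi> in lborel. norm (k c \<xi> *\<^sub>R g \<xi>) \<le> norm (M * k c \<xi>)"
      using M M0 by (auto simp: abs_mult mult.commute intro!: mult_right_mono)
  qed measurable
  \<comment> \<open>On \<open>{0..u}\<close> the kernel decreases in its upper limit, as
    \<open>\<beta> < 1\<close>; beyond \<open>u\<close> only the kernel of \<open>v\<close> remains.
    At \<open>u\<close> itself the two indicators overlap, so that point is excluded below.\<close>
  define D where "D = (\<lambda>\<xi>. k u \<xi> - indicator {0..u} \<xi> * (v - \<xi>) powr (\<beta> - 1) + indicator {u..v} \<xi> * (v - \<xi>) powr (\<beta> - 1))"
  have D: "has_bochner_integral lborel D (u powr \<beta> / \<beta> - (v powr \<beta> - (v - u) powr \<beta>) / \<beta> + (v - u) powr \<beta> / \<beta>)"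
    unfolding D_def using i1[OF u(1)] has_bochner_integral_powr_kernel[of \<beta> 0 u v]
      has_bochner_integral_powr_kernel[of \<beta> u v v] \<beta> u
    by (intro has_bochner_integral_add has_bochner_integral_diff) auto
  have kD: "\<bar>k v \<xi> - k u \<xi>\<bar> \<le> D \<xi>" if "\<xi> \<noteq> u" for \<xi>
  proof -
    have "(v - \<xi>) powr (\<beta> - 1) \<le> (u - \<xi>) powr (\<beta> - 1)" if "\<xi> < u"
      using that u \<beta> by (intro powr_mono2') auto
    then show ?thesis using that u by (auto simp: k_def D_def indicator_def abs_if)
  qed
  have "F v - F u = (\<integral>\<xi>. (k v \<xi> - k u \<xi>) *\<^sub>R g \<xi> \<partial>lborel)"
    using ig u by (simp add: F_def k_def scaleR_diff_left flip: Bochner_Integration.integral_diff)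
  also have "norm \<dots> \<le> (\<integral>\<xi>. norm ((k v \<xi> - k u \<xi>) *\<^sub>R g \<xi>) \<partial>lborel)"
    by (rule integral_norm_bound)
  also have "\<dots> \<le> (\<integral>\<xi>. M * D \<xi> \<partial>lborel)"
  proof (rule integral_mono_AE)
    show "integrable lborel (\<lambda>\<xi>. M * D \<xi>)" using D by (simp add: has_bochner_integral_iff)
    show "integrable lborel (\<lambda>\<xi>. norm ((k v \<xi> - k u \<xi>) *\<^sub>R g \<xi>))"
      unfolding scaleR_diff_left using ig u by auto
    show "AE \<xi> in lborel. norm ((k v \<xi> - k u \<xi>) *\<^sub>R g \<xi>) \<le> M * D \<xi>"
      using AE_lborel_singleton[of u]
    proof eventually_elim
      case (elim \<xi>)
      have "norm ((k v \<xi> - k u \<xi>) *\<^sub>R g \<xi>) \<le> D \<xi> * M"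
        using kD[OF elim] M[of \<xi>] unfolding norm_scaleR real_norm_def
        by (intro mult_mono) auto
      then show ?case by (simp add: mult.commute)
    qed
  qed
  also have "\<dots> = M * (u powr \<beta> / \<beta> - (v powr \<beta> - (v - u) powr \<beta>) / \<beta> + (v - u) powr \<beta> / \<beta>)"
    using D by (simp add: has_bochner_integral_iff)
  also have "\<dots> \<le> M * (2 / \<beta> * (v - u) powr \<beta>)"
  proof (rule mult_left_mono[OF _ M0])
    have "u powr \<beta> \<le> v powr \<beta>" using u \<beta> by (intro powr_mono2) auto
    then have "u powr \<beta> / \<beta> \<le> v powr \<beta> / \<beta>" using \<beta> by (intro divide_right_mono) auto
    then show "u powr \<beta> / \<beta> - (v powr \<beta> - (v - u) powr \<beta>) / \<beta> + (v - u) powr \<beta> / \<beta> \<le> 2 / \<beta> * (v - u) powr \<beta>"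
      by (simp add: diff_divide_distrib)
  qed
  finally show ?thesis by (simp add: mult_ac)
qed

text \<open>Supplies densities that are Borel and bounded everywhere, so that Fubini's theorem over
  \<open>lborel\<close> applies to them and bounds hold without exceptional sets.\<close>

lemma borel_representative_bounded:
  fixes f :: "'a::euclidean_space \<Rightarrow> 'b::euclidean_space"
  assumes S: "S \<in> sets lebesgue" and f: "f \<in> borel_measurable (lebesgue_on S)"
    and M: "AE x in lebesgue_on S. norm (f x) \<le> M"
  obtains g where "g \<in> borel_measurable borel" "\<And>x. norm (g x) \<le> \<bar>M\<bar>"
    "AE x in lebesgue_on S. f x = g x"
proof -
  define F where "F = (\<lambda>x. if x \<in> S then f x else 0)"
  have F: "F \<in> borel_measurable lebesgue"
    unfolding F_def using S f by (simp add: borel_measurable_if)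
  \<comment> \<open>Borel versions are taken coordinate by coordinate and reassembled in
    \<open>G\<close>.\<close>
  have "\<exists>h. h \<in> borel_measurable lborel \<and> (AE x in lborel. F x \<bullet> b = h x)" for b
    using completion_ex_borel_measurable_real[of "\<lambda>x. F x \<bullet> b" lborel] F by auto
  then obtain h where h: "\<And>b. h b \<in> borel_measurable lborel" "\<And>b. AE x in lborel. F x \<bullet> b = h b x"
    by metis
  define G where "G = (\<lambda>x. \<Sum>b\<in>Basis. h b x *\<^sub>R b)"
  \<comment> \<open>Resetting the values above the bound changes \<open>G\<close> only on a null
    subset of \<open>S\<close>. The absolute value covers a negative \<open>M\<close>, possible when
    \<open>S\<close> is null.\<close>
  define g where "g = (\<lambda>x. if norm (G x) \<le> \<bar>M\<bar> then G x else 0)"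
  have [measurable]: "h b \<in> borel_measurable borel" for b using h(1)[of b] by simp
  have [measurable]: "G \<in> borel_measurable borel" unfolding G_def by measurable
  have "AE x in lborel. \<forall>b\<in>Basis. F x \<bullet> b = h b x"
    using h(2) by (intro AE_finite_allI) auto
  then have "AE x in lborel. F x = G x"
  proof eventually_elim
    case (elim x)
    have "F x = (\<Sum>b\<in>Basis. (F x \<bullet> b) *\<^sub>R b)" by (simp add: euclidean_representation)
    also have "\<dots> = G x" unfolding G_def using elim by (intro sum.cong) auto
    finally show ?case .
  qed
  then have "AE x in lebesgue. F x = G x" by (rule AE_completion)
  then have "AE x in lebesgue_on S. f x = G x"
    using S by (subst AE_restrict_space_iff) (auto simp: F_def elim: eventually_mono)
  then have "AE x in lebesgue_on S. f x = g x"
    using M by eventually_elim (auto simp: g_def)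
  moreover have "g \<in> borel_measurable borel" unfolding g_def by measurable
  moreover have "norm (g x) \<le> \<bar>M\<bar>" for x by (simp add: g_def)
  ultimately show ?thesis by (rule that[rotated -1])
qed

section \<open>The fractional integral of Borel functions\<close>

lemma frac_integral_cong:
  assumes "\<And>\<xi>. \<xi> \<in> {0..\<tau>} \<Longrightarrow> f \<xi> = g \<xi>"
  shows "frac_integral \<beta> f \<tau> = frac_integral \<beta> g \<tau>"
  unfolding frac_integral_def using assms
  by (intro arg_cong2[where f=scaleR] Bochner_Integration.integral_cong) auto

lemma borel_measurable_lebesgue_onI:
  "f \<in> borel_measurable borel \<Longrightarrow> f \<in> borel_measurable (lebesgue_on S)"
  by (intro measurable_restrict_space1 measurable_completion) simp

lemma frac_integral_cong_AE:
  fixes f g :: "real \<Rightarrow> real ^ 'n::finite"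
  assumes \<tau>: "\<tau> \<le> t"
    and f: "f \<in> borel_measurable (lebesgue_on {0..t})" and g: "g \<in> borel_measurable (lebesgue_on {0..t})"
    and eq: "AE \<xi> in lebesgue_on {0..t}. f \<xi> = g \<xi>"
  shows "frac_integral \<beta> f \<tau> = frac_integral \<beta> g \<tau>"
proof -
  have k: "(\<lambda>\<xi>. 1 / (\<tau> - \<xi>) powr (1 - \<beta>)) \<in> borel_measurable (lebesgue_on {0..\<tau>})"
    by (rule borel_measurable_lebesgue_onI) measurable
  have sub: "f \<in> borel_measurable (lebesgue_on {0..\<tau>})" "g \<in> borel_measurable (lebesgue_on {0..\<tau>})"
    using f g \<tau> by (auto elim: measurable_restrict_mono)
  have "AE \<xi> in lebesgue_on {0..\<tau>}. f \<xi> = g \<xi>"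
    using eq \<tau> by (subst AE_restrict_space_iff; simp?) (subst (asm) AE_restrict_space_iff; auto elim: eventually_mono)
  then show ?thesis
    unfolding frac_integral_def using sub k
    by (intro arg_cong2[where f=scaleR] integral_cong_AE borel_measurable_scaleR) (auto elim: eventually_mono)
qed

text \<open>Translates the defining integral into the \<open>lborel\<close> form with an indicator
  in which the kernel estimates are stated.\<close>

lemma frac_integral_borel:
  fixes g :: "real \<Rightarrow> real ^ 'n::finite"
  assumes g [measurable]: "g \<in> borel_measurable borel"
  shows "frac_integral \<beta> g \<tau> = (1 / Gamma \<beta>) *\<^sub>R
    (\<integral>\<xi>. (indicator {0..\<tau>} \<xi> * (\<tau> - \<xi>) powr (\<beta> - 1)) *\<^sub>R g \<xi> \<partial>lborel)"
proof -
  have p: "1 / (\<tau> - \<xi>) powr (1 - \<beta>) = (\<tau> - \<xi>) powr (\<beta> - 1)" for \<xi>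
    using powr_minus_divide[of "\<tau> - \<xi>" "1 - \<beta>"] by simp
  have "(LINT \<xi>|lebesgue_on {0..\<tau>}. (1 / (\<tau> - \<xi>) powr (1 - \<beta>)) *\<^sub>R g \<xi>)
    = (LINT \<xi>|lebesgue. (indicator {0..\<tau>} \<xi> * (\<tau> - \<xi>) powr (\<beta> - 1)) *\<^sub>R g \<xi>)"
    by (subst integral_restrict_space) (auto simp: p)
  also have "\<dots> = (\<integral>\<xi>. (indicator {0..\<tau>} \<xi> * (\<tau> - \<xi>) powr (\<beta> - 1)) *\<^sub>R g \<xi> \<partial>lborel)"
    by (rule integral_completion) measurable
  finally show ?thesis by (simp add: frac_integral_def)
qed

lemma frac_integral_measurable [measurable]:
  fixes g :: "real \<Rightarrow> real ^ 'n::finite"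
  assumes g [measurable]: "g \<in> borel_measurable borel"
  shows "frac_integral \<beta> g \<in> borel_measurable borel"
proof -
  \<comment> \<open>Written as a condition, the range of integration is visibly measurable in
    \<open>\<tau>\<close> and \<open>\<xi>\<close> jointly.\<close>
  have "frac_integral \<beta> g = (\<lambda>\<tau>. (1 / Gamma \<beta>) *\<^sub>R
    (\<integral>\<xi>. (if 0 \<le> \<xi> \<and> \<xi> \<le> \<tau> then (\<tau> - \<xi>) powr (\<beta> - 1) else 0) *\<^sub>R g \<xi> \<partial>lborel))"
    unfolding frac_integral_borel[OF g] fun_eq_iff
    by (intro allI arg_cong2[where f=scaleR] refl Bochner_Integration.integral_cong) auto
  also have "\<dots> \<in> borel_measurable borel" by measurable
  finally show ?thesis .
qed

lemma frac_integral_Hoelder: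
  fixes g :: "real \<Rightarrow> real ^ 'n::finite"
  assumes \<beta>: "0 < \<beta>" "\<beta> < 1" and g: "g \<in> borel_measurable borel" and M: "\<And>x. norm (g x) \<le> M"
    and u: "0 \<le> u" "u \<le> v"
  shows "norm (frac_integral \<beta> g v - frac_integral \<beta> g u) \<le> 2 * M / (\<beta> * Gamma \<beta>) * (v - u) powr \<beta>"
proof -
  have G: "Gamma \<beta> > 0" using \<beta> by (simp add: Gamma_real_pos)
  have "norm (frac_integral \<beta> g v - frac_integral \<beta> g u) = 1 / Gamma \<beta> *
    norm ((\<integral>\<xi>. (indicator {0..v} \<xi> * (v - \<xi>) powr (\<beta> - 1)) *\<^sub>R g \<xi> \<partial>lborel) -
      (\<integral>\<xi>. (indicator {0..u} \<xi> * (u - \<xi>) powr (\<beta> - 1)) *\<^sub>R g \<xi> \<partial>lborel))"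
    unfolding frac_integral_borel[OF g] scaleR_diff_right[symmetric] norm_scaleR using G by simp
  also have "\<dots> \<le> 1 / Gamma \<beta> * (2 * M / \<beta> * (v - u) powr \<beta>)"
    using G by (intro mult_left_mono powr_kernel_integral_bound[OF \<beta> g M u]) auto
  finally show ?thesis by (simp add: field_simps)
qed

text \<open>The factor \<open>Beta \<alpha> (1 - \<alpha>) = Gamma \<alpha> * Gamma (1 -
  \<alpha>)\<close> from Fubini's theorem cancels the two normalising constants.\<close>

lemma frac_integral_complement:
  fixes g :: "real \<Rightarrow> real ^ 'n::finite"
  assumes \<alpha>: "0 < \<alpha>" "\<alpha> < 1" and g [measurable]: "g \<in> borel_measurable borel"
    and M: "\<And>x. norm (g x) \<le> M"
  shows "frac_integral (1 - \<alpha>) (frac_integral \<alpha> g) s = integral {0..s} g"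
proof -
  have G: "Gamma \<alpha> > 0" "Gamma (1 - \<alpha>) > 0" using \<alpha> by (auto simp: Gamma_real_pos)
  have "set_integrable lborel {0..s} g"
    unfolding set_integrable_def
    using M by (intro integrableI_bounded_set_indicator[where B=M]) (auto simp: emeasure_lborel_Icc_eq)
  then have I: "(\<integral>\<xi>. indicator {0..s} \<xi> *\<^sub>R g \<xi> \<partial>lborel) = integral {0..s} g"
    using set_borel_integral_eq_integral(2) unfolding set_lebesgue_integral_def by blast
  have "frac_integral (1 - \<alpha>) (frac_integral \<alpha> g) s = (1 / Gamma (1 - \<alpha>)) *\<^sub>R
    (\<integral>\<eta>. (indicator {0..s} \<eta> * (s - \<eta>) powr (- \<alpha>)) *\<^sub>R (frac_integral \<alpha> g \<eta>) \<partial>lborel)"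
    using frac_integral_borel[of "frac_integral \<alpha> g" "1 - \<alpha>" s] by simp
  also have "(\<integral>\<eta>. (indicator {0..s} \<eta> * (s - \<eta>) powr (- \<alpha>)) *\<^sub>R (frac_integral \<alpha> g \<eta>) \<partial>lborel)
    = (\<integral>\<eta>. (1 / Gamma \<alpha>) *\<^sub>R ((indicator {0..s} \<eta> * (s - \<eta>) powr (- \<alpha>)) *\<^sub>R
        (\<integral>\<xi>. (indicator {0..\<eta>} \<xi> * (\<eta> - \<xi>) powr (\<alpha> - 1)) *\<^sub>R g \<xi> \<partial>lborel)) \<partial>lborel)"
    unfolding frac_integral_borel[OF g] by (simp add: mult.commute)
  also have "\<dots> = (1 / Gamma \<alpha>) *\<^sub>R (Beta \<alpha> (1 - \<alpha>) *\<^sub>R integral {0..s} g)"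
    unfolding integral_scaleR_right fractional_kernel_complement[OF \<alpha> g M] I ..
  finally show ?thesis using G by (simp add: Beta_def)
qed

section \<open>Functions of class \<open>AC\<close>\<close>

lemma AC_representation:
  fixes x :: "real \<Rightarrow> real ^ 'n::finite"
  assumes "x \<in> AC \<alpha> T"
  obtains g M where "g \<in> borel_measurable borel" "\<And>\<xi>. norm (g \<xi>) \<le> M"
    "\<And>\<tau>. \<tau> \<in> {0..T} \<Longrightarrow> x \<tau> = x 0 + frac_integral \<alpha> g \<tau>"
proof -
  obtain \<psi> where \<psi>: "\<psi> \<in> ess_bounded T" "\<forall>\<tau>\<in>{0..T}. x \<tau> = x 0 + frac_integral \<alpha> \<psi> \<tau>"
    using assms by (auto simp: AC_def)
  then obtain B where m: "\<psi> \<in> borel_measurable (lebesgue_on {0..T})"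
    and B: "AE \<tau> in lebesgue_on {0..T}. norm (\<psi> \<tau>) \<le> B" by (auto simp: ess_bounded_def)
  \<comment> \<open>An almost everywhere change of the density leaves all its fractional integrals
    unchanged, hence also the representation of \<open>x\<close>.\<close>
  obtain g where g: "g \<in> borel_measurable borel" "\<And>x. norm (g x) \<le> \<bar>B\<bar>"
    "AE \<xi> in lebesgue_on {0..T}. \<psi> \<xi> = g \<xi>"
    using borel_representative_bounded[OF _ m B] by auto
  show ?thesis
  proof (rule that[OF g(1,2)])
    fix \<tau> assume \<tau>: "\<tau> \<in> {0..T}"
    then have "frac_integral \<alpha> \<psi> \<tau> = frac_integral \<alpha> g \<tau>"
      by (intro frac_integral_cong_AE[OF _ m borel_measurable_lebesgue_onI[OF g(1)] g(3)]) simp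
    with \<psi>(2) \<tau> show "x \<tau> = x 0 + frac_integral \<alpha> g \<tau>" by metis
  qed
qed

text \<open>Follows from the Hoelder estimate of order \<open>\<alpha>\<close> for the fractional
  integral of a bounded density.\<close>

lemma AC_continuous_on:
  fixes x :: "real \<Rightarrow> real ^ 'n::finite"
  assumes \<alpha>: "0 < \<alpha>" "\<alpha> < 1" and x: "x \<in> AC \<alpha> T"
  shows "continuous_on {0..T} x"
proof -
  obtain g M where g: "g \<in> borel_measurable borel" "\<And>\<xi>. norm (g \<xi>) \<le> M"
    and rep: "\<And>\<tau>. \<tau> \<in> {0..T} \<Longrightarrow> x \<tau> = x 0 + frac_integral \<alpha> g \<tau>"
    using AC_representation[OF x] by blast
  define C where "C = 2 * M / (\<alpha> * Gamma \<alpha>)"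
  have le: "dist (x v) (x u) \<le> C * (v - u) powr \<alpha>"
    if "u \<in> {0..T}" "v \<in> {0..T}" "u \<le> v" for u v
    using frac_integral_Hoelder[OF \<alpha> g, of u v] that
    unfolding C_def dist_norm rep[OF that(1)] rep[OF that(2)] by simp
  have *: "dist (x v) (x u) \<le> C * \<bar>v - u\<bar> powr \<alpha>" if "u \<in> {0..T}" "v \<in> {0..T}" for u v
    using le[of u v] le[of v u] that by (cases "u \<le> v") (auto simp: dist_commute)
  show ?thesis
    unfolding continuous_on_def
  proof
    fix u assume u: "u \<in> {0..T}"
    have "((\<lambda>v. C * \<bar>v - u\<bar> powr \<alpha>) \<longlongrightarrow> C * \<bar>u - u\<bar> powr \<alpha>) (at u within {0..T})"
      using \<alpha> by (intro tendsto_intros tendsto_powr') auto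
    then have "((\<lambda>v. C * \<bar>v - u\<bar> powr \<alpha>) \<longlongrightarrow> 0) (at u within {0..T})" using \<alpha> by simp
    then show "(x \<longlongrightarrow> x u) (at u within {0..T})"
      by (rule metric_tendsto_imp_tendsto)
        (use *[OF u] in \<open>auto simp: eventually_at_filter dist_real_def intro!: always_eventually order_trans[OF _ abs_ge_self]\<close>)
  qed
qed

text \<open>The same density serves, since a fractional integral at \<open>\<sigma>\<close> sees
  only \<open>{0..\<sigma>}\<close>.\<close>

lemma AC_restrict:
  assumes x: "x \<in> AC \<alpha> T" and \<tau>: "0 \<le> \<tau>" "\<tau> \<le> T"
  shows "restrict x {0..\<tau>} \<in> AC \<alpha> \<tau>"
proof -
  obtain \<psi> where \<psi>: "\<psi> \<in> ess_bounded T" "\<forall>\<tau>\<in>{0..T}. x \<tau> = x 0 + frac_integral \<alpha> \<psi> \<tau>"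
    using x by (auto simp: AC_def)
  then obtain B where m: "\<psi> \<in> borel_measurable (lebesgue_on {0..T})"
    and B: "AE \<tau> in lebesgue_on {0..T}. norm (\<psi> \<tau>) \<le> B" by (auto simp: ess_bounded_def)
  have "\<psi> \<in> borel_measurable (lebesgue_on {0..\<tau>})"
    using m \<tau> by (auto elim: measurable_restrict_mono)
  moreover have "AE \<xi> in lebesgue_on {0..\<tau>}. norm (\<psi> \<xi>) \<le> B"
    using B \<tau> by (subst AE_restrict_space_iff; simp?) (subst (asm) AE_restrict_space_iff; auto elim: eventually_mono)
  ultimately have "\<psi> \<in> ess_bounded \<tau>" by (auto simp: ess_bounded_def)
  moreover have "restrict x {0..\<tau>} \<sigma> = restrict x {0..\<tau>} 0 + frac_integral \<alpha> \<psi> \<sigma>"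
    if \<sigma>: "\<sigma> \<in> {0..\<tau>}" for \<sigma>
  proof -
    have "x \<sigma> = x 0 + frac_integral \<alpha> \<psi> \<sigma>" using \<psi>(2) \<sigma> \<tau> by (meson atLeastAtMost_iff order_trans)
    moreover have "restrict x {0..\<tau>} \<sigma> = x \<sigma>" "restrict x {0..\<tau>} 0 = x 0" using \<sigma> \<tau> by simp_all
    ultimately show ?thesis by (simp only:)
  qed
  ultimately show ?thesis
    unfolding AC_def by (intro CollectI conjI restrict_extensional bexI[of _ \<psi>] ballI)
qed

text \<open>This identity, valid at every \<open>s\<close>, yields both the Lipschitz continuity of
  the fractional integral and its derivative almost everywhere.\<close>

lemma frac_integral_AC:
  fixes x :: "real \<Rightarrow> real ^ 'n::finite"
  assumes \<alpha>: "0 < \<alpha>" "\<alpha> < 1" and x: "x \<in> AC \<alpha> T"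
  obtains g M where "g integrable_on {0..T}" "\<And>\<xi>. norm (g \<xi>) \<le> M"
    "\<And>s. s \<in> {0..T} \<Longrightarrow> frac_integral (1 - \<alpha>) (\<lambda>\<xi>. x \<xi> - x 0) s = integral {0..s} g"
proof -
  obtain g M where g: "g \<in> borel_measurable borel" "\<And>\<xi>. norm (g \<xi>) \<le> M"
    and rep: "\<And>\<tau>. \<tau> \<in> {0..T} \<Longrightarrow> x \<tau> = x 0 + frac_integral \<alpha> g \<tau>"
    using AC_representation[OF x] by blast
  have eq: "frac_integral (1 - \<alpha>) (\<lambda>\<xi>. x \<xi> - x 0) s = integral {0..s} g" if "s \<in> {0..T}" for s
  proof -
    have "frac_integral (1 - \<alpha>) (\<lambda>\<xi>. x \<xi> - x 0) s = frac_integral (1 - \<alpha>) (frac_integral \<alpha> g) s"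
    proof (rule frac_integral_cong)
      fix \<xi> assume "\<xi> \<in> {0..s}"
      then have "x \<xi> = x 0 + frac_integral \<alpha> g \<xi>" using that by (intro rep) auto
      then show "x \<xi> - x 0 = frac_integral \<alpha> g \<xi>" by (metis add_diff_cancel_left')
    qed
    then show ?thesis using frac_integral_complement[OF \<alpha> g] by simp
  qed
  have "set_integrable lborel {0..T} g"
    unfolding set_integrable_def
    using g by (intro integrableI_bounded_set_indicator[where B=M]) (auto simp: emeasure_lborel_Icc_eq)
  then have "g integrable_on {0..T}" by (rule set_borel_integral_eq_integral(1))
  then show ?thesis using g(2) eq by (rule that)
qed

lemma lipschitz_on_integral:
  fixes g :: "real \<Rightarrow> 'a::euclidean_space"
  assumes g: "g integrable_on {a..b}" and M: "\<And>\<xi>. norm (g \<xi>) \<le> M"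
  shows "M-lipschitz_on {a..b} (\<lambda>s. integral {a..s} g)"
proof (rule lipschitz_onI)
  show M0: "0 \<le> M" using M[of 0] norm_ge_zero order_trans by blast
  have *: "dist (integral {a..v} g) (integral {a..u} g) \<le> M * (v - u)"
    if "u \<in> {a..b}" "v \<in> {a..b}" "u \<le> v" for u v
  proof -
    have "integral {a..u} g + integral {u..v} g = integral {a..v} g"
      using that by (intro Henstock_Kurzweil_Integration.integral_combine integrable_subinterval_real[OF g]) auto
    then have "dist (integral {a..v} g) (integral {a..u} g) = norm (integral (cbox u v) g)"
      by (simp add: dist_norm algebra_simps flip: \<open>_ = integral {a..v} g\<close>)
    also have "\<dots> \<le> M * measure lborel (cbox u v)"
      using integrable_subinterval_real[OF g, of u v] that M M0 by (intro integrable_bound) auto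
    finally show ?thesis using that by simp
  qed
  show "dist (integral {a..u} g) (integral {a..v} g) \<le> M * dist u v"
    if "u \<in> {a..b}" "v \<in> {a..b}" for u v
    using *[of u v] *[of v u] that by (cases "u \<le> v") (auto simp: dist_real_def dist_commute)
qed

section \<open>Functionals along a trajectory\<close>

text \<open>A time \<open>\<tau> \<le> s'\<close> is matched with itself and a later one with the
  endpoint \<open>s'\<close>, so only the variation of \<open>x\<close> between \<open>s'\<close>
  and \<open>s\<close> contributes.\<close>

lemma semi_dist_restrict_le:
  fixes x :: "real \<Rightarrow> real ^ 'n::finite"
  assumes s: "0 \<le> s" "0 \<le> s'" and e: "0 \<le> e"
    and near: "\<And>\<tau>. \<lbrakk>s' \<le> \<tau>; \<tau> \<le> s\<rbrakk> \<Longrightarrow> \<bar>\<tau> - s'\<bar> + norm (x \<tau> - x s') \<le> e"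
  shows "semi_dist (s, restrict x {0..s}) (s', restrict x {0..s'}) \<le> e"
  unfolding semi_dist_def split
proof (rule cSUP_least)
  show "{0..s} \<noteq> {}" using s by simp
  fix \<tau> assume \<tau>: "\<tau> \<in> {0..s}"
  show "(INF \<tau>'\<in>{0..s'}. sqrt (\<bar>\<tau> - \<tau>'\<bar>\<^sup>2 + (norm (restrict x {0..s} \<tau> - restrict x {0..s'} \<tau>'))\<^sup>2)) \<le> e"
  proof (rule cINF_lower2)
    show "bdd_below ((\<lambda>\<tau>'. sqrt (\<bar>\<tau> - \<tau>'\<bar>\<^sup>2 + (norm (restrict x {0..s} \<tau> - restrict x {0..s'} \<tau>'))\<^sup>2)) ` {0..s'})"
      by (rule bdd_belowI[of _ 0]) auto
    show "min \<tau> s' \<in> {0..s'}" using \<tau> s by auto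
    show "sqrt (\<bar>\<tau> - min \<tau> s'\<bar>\<^sup>2 + (norm (restrict x {0..s} \<tau> - restrict x {0..s'} (min \<tau> s')))\<^sup>2) \<le> e"
    proof (cases "\<tau> \<le> s'")
      case True
      then show ?thesis using \<tau> e by simp
    next
      case False
      have "sqrt (\<bar>\<tau> - s'\<bar>\<^sup>2 + (norm (x \<tau> - x s'))\<^sup>2) \<le> \<bar>\<tau> - s'\<bar> + norm (x \<tau> - x s')"
        by (rule sqrt_sum_squares_le_sum) auto
      also have "\<dots> \<le> e" using False \<tau> by (intro near) auto
      finally show ?thesis using False \<tau> s by (simp add: min_def)
    qed
  qed
qed

text \<open>Uniform continuity of \<open>x\<close> makes the curve of its restrictions continuous
  for \<open>pos_dist\<close>; composition with \<open>f\<close> gives the claim.\<close>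

lemma continuous_on_pos_restrict:
  fixes x :: "real \<Rightarrow> real ^ 'n::finite"
  assumes f: "pos_continuous_on P f" and x: "continuous_on {0..T} x"
    and I: "I \<subseteq> {0..T}" and P: "\<And>\<tau>. \<tau> \<in> I \<Longrightarrow> (\<tau>, restrict x {0..\<tau>}) \<in> P"
  shows "continuous_on I (\<lambda>\<tau>. f (\<tau>, restrict x {0..\<tau>}))"
  unfolding continuous_on_iff
proof (intro ballI allI impI)
  fix s e :: real assume s: "s \<in> I" and e: "0 < e"
  then obtain d where d: "d > 0" and dd: "\<And>q. \<lbrakk>q \<in> P; pos_dist q (s, restrict x {0..s}) < d\<rbrakk> \<Longrightarrow>
      dist (f q) (f (s, restrict x {0..s})) < e"
    using f P[OF s] unfolding pos_continuous_on_def by blast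
  have "uniformly_continuous_on {0..T} x" using x by (simp add: compact_uniformly_continuous)
  \<comment> \<open>A quarter of \<open>d\<close> each for time and space gives distance at most
    \<open>d / 2\<close>, leaving room for the strict inequality lost in the supremum.\<close>
  then obtain \<delta> where \<delta>: "\<delta> > 0" "\<And>u v. \<lbrakk>u \<in> {0..T}; v \<in> {0..T}; dist v u < \<delta>\<rbrakk> \<Longrightarrow> dist (x v) (x u) < d / 4"
    using d unfolding uniformly_continuous_on_def by (metis divide_pos_pos zero_less_numeral)
  have le: "semi_dist (u, restrict x {0..u}) (v, restrict x {0..v}) \<le> d / 2"
    if uv: "u \<in> {0..T}" "v \<in> {0..T}" "\<bar>u - v\<bar> < min \<delta> (d / 4)" for u v
  proof (rule semi_dist_restrict_le)
    fix \<tau> assume \<tau>: "v \<le> \<tau>" "\<tau> \<le> u"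
    then have "dist (x \<tau>) (x v) < d / 4" using uv by (intro \<delta>) (auto simp: dist_real_def)
    then show "\<bar>\<tau> - v\<bar> + norm (x \<tau> - x v) \<le> d / 2" using uv \<tau> by (simp add: dist_norm)
  qed (use uv d in auto)
  show "\<exists>d>0. \<forall>x'\<in>I. dist x' s < d \<longrightarrow> dist (f (x', restrict x {0..x'})) (f (s, restrict x {0..s})) < e"
  proof (intro exI conjI ballI impI)
    show "0 < min \<delta> (d / 4)" using \<delta> d by simp
    fix r assume r: "r \<in> I" "dist r s < min \<delta> (d / 4)"
    moreover have "r \<in> {0..T}" "s \<in> {0..T}" using r s I by auto
    ultimately have "pos_dist (r, restrict x {0..r}) (s, restrict x {0..s}) \<le> d / 2"
      using le[of r s] le[of s r] by (simp add: pos_dist_def dist_real_def abs_minus_commute)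
    then show "dist (f (r, restrict x {0..r})) (f (s, restrict x {0..s})) < e"
      using d by (intro dd P r) auto
  qed
qed

theorem lemma9p2:
  fixes \<alpha> T t \<theta> :: real
    and \<phi> :: "'n::finite position \<Rightarrow> real"
    and w x :: "real \<Rightarrow> real ^ 'n"
  assumes "0 < T" and "0 < \<alpha>" and "\<alpha> < 1"
    and "ci_smooth \<alpha> T \<phi>"
    and "(t, w) \<in> positions0 \<alpha> T"
    and "x \<in> extensions \<alpha> T (t, w)"
    and "\<theta> \<in> {t..<T}"
  shows "let \<omega> = (\<lambda>\<tau>. \<phi> (\<tau>, restrict x {0..\<tau>})) in
    continuous_on {t..T} \<omega> \<and>
    (\<exists>L. L-lipschitz_on {t..\<theta>} \<omega>) \<and>
    (AE \<tau> in lebesgue_on {t..\<theta>}.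
       (\<omega> has_real_derivative
          (ci_dt \<alpha> T \<phi> (\<tau>, restrict x {0..\<tau>})
           + ci_grad \<alpha> T \<phi> (\<tau>, restrict x {0..\<tau>}) \<bullet> caputo_derivative \<alpha> x \<tau>)) (at \<tau>))"
proof -
  define pos where "pos = (\<lambda>\<tau>. (\<tau>, restrict x {0..\<tau>}))"
  define \<omega> where "\<omega> = (\<lambda>\<tau>. \<phi> (pos \<tau>))"
  define a where "a = (\<lambda>\<tau>. ci_dt \<alpha> T \<phi> (pos \<tau>))"
  define v where "v = (\<lambda>\<tau>. ci_grad \<alpha> T \<phi> (pos \<tau>))"
  define J where "J = frac_integral (1 - \<alpha>) (\<lambda>\<xi>. x \<xi> - x 0)"
  have x: "x \<in> AC \<alpha> T" using assms(6) by (simp add: extensions_def)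
  have t: "0 \<le> t" "t < T" using assms(5) by (auto simp: positions0_def positions_def)
  have cont_x: "continuous_on {0..T} x" using AC_continuous_on assms(2,3) x by blast
  have pos: "pos \<tau> \<in> positions \<alpha> T" if "\<tau> \<in> {0..T}" for \<tau>
    using that AC_restrict[OF x] by (auto simp: pos_def positions_def)
  then have pos0: "pos \<tau> \<in> positions0 \<alpha> T" if "\<tau> \<in> {0..<T}" for \<tau>
    using that by (force simp: pos_def positions0_def)
  have \<omega>_cont: "continuous_on {0..T} \<omega>"
    unfolding \<omega>_def pos_def
  proof (rule continuous_on_pos_restrict[OF _ cont_x])
    show "pos_continuous_on (positions \<alpha> T) \<phi>" using assms(4) by (simp add: ci_smooth_def)
  qed (use pos in \<open>auto simp: pos_def\<close>)
  \<comment> \<open>A general codomain lets this serve both \<open>ci_dt\<close> and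
    \<open>ci_grad\<close>, whose continuity is given on \<open>positions0\<close>, hence before
    \<open>T\<close>.\<close>
  have cont0: "continuous_on {0..<T} (\<lambda>\<tau>. f (pos \<tau>))"
    if "pos_continuous_on (positions0 \<alpha> T) f" for f :: "'n position \<Rightarrow> 'c::metric_space"
    unfolding pos_def using pos0[unfolded pos_def]
    by (intro continuous_on_pos_restrict[OF that cont_x]) auto
  have a_cont: "continuous_on {0..<T} a" and v_cont: "continuous_on {0..<T} v"
    using assms(4) unfolding a_def v_def ci_smooth_def by (auto intro: cont0)
  obtain g M where g: "g integrable_on {0..T}" "\<And>\<xi>. norm (g \<xi>) \<le> M"
    and J_eq: "\<And>s. s \<in> {0..T} \<Longrightarrow> J s = integral {0..s} g"
    unfolding J_def using frac_integral_AC[OF assms(2,3) x] by blast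
  have J_lip: "M-lipschitz_on {0..T} J"
    using lipschitz_on_integral[OF g] J_eq by (simp add: lipschitz_on_def)
  \<comment> \<open>Since \<open>x\<close> extends each of its own restrictions, differentiability
    of \<open>\<phi>\<close> applies along \<open>x\<close> at every \<open>s < T\<close>, not just
    at the initial position.\<close>
  have incr: "\<forall>\<^sub>F r in at_right s. \<bar>\<omega> r - \<omega> s - a s * (r - s) - v s \<bullet> (J r - J s)\<bar> \<le> e * (r - s)"
    if s: "s \<in> {0..<T}" and e: "e > 0" for s e
  proof -
    have "has_ci_derivative \<alpha> T \<phi> (pos s) (ci_derivative \<alpha> T \<phi> (pos s))"
      using assms(4) pos0[OF s] unfolding ci_smooth_def ci_differentiable_def ci_derivative_def
      by (blast intro: someI_ex)
    then have "has_ci_derivative \<alpha> T \<phi> (pos s) (a s, v s)"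
      by (simp add: a_def v_def ci_dt_def ci_grad_def)
    moreover have "x \<in> extensions \<alpha> T (pos s)"
      using x by (simp add: extensions_def pos_def)
    ultimately have "(\<lambda>\<tau>. \<omega> \<tau> - \<omega> s - a s * (\<tau> - s) - v s \<bullet> (J \<tau> -
        frac_integral (1 - \<alpha>) (\<lambda>\<xi>. restrict x {0..s} \<xi> - restrict x {0..s} 0) s)) \<in> o[at_right s](\<lambda>\<tau>. \<tau> - s)"
      by (simp add: has_ci_derivative_def pos_def \<omega>_def J_def)
    also have "frac_integral (1 - \<alpha>) (\<lambda>\<xi>. restrict x {0..s} \<xi> - restrict x {0..s} 0) s = J s"
      unfolding J_def using s by (intro frac_integral_cong) auto
    finally have "\<forall>\<^sub>F \<tau> in at_right s. norm (\<omega> \<tau> - \<omega> s - a s * (\<tau> - s) - v s \<bullet> (J \<tau> - J s)) \<le> e * norm (\<tau> - s)"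
      using e by (rule landau_o.smallD)
    moreover have "\<forall>\<^sub>F \<tau> in at_right s. s < \<tau>" by (rule eventually_at_right_less)
    ultimately show ?thesis by eventually_elim simp
  qed
  have "\<exists>L. L-lipschitz_on {t..\<theta>} \<omega>"
  proof (rule chain_lipschitz_on[of t \<theta> \<omega> M J a v])
    show "continuous_on {t..\<theta>} \<omega>" "continuous_on {t..\<theta>} a" "continuous_on {t..\<theta>} v"
      using t assms(7) by (auto intro: continuous_on_subset[OF \<omega>_cont] continuous_on_subset[OF a_cont]
        continuous_on_subset[OF v_cont])
    show "M-lipschitz_on {t..\<theta>} J" using t assms(7) by (auto intro: lipschitz_on_subset[OF J_lip])
  qed (use t assms(7) in \<open>auto intro!: incr\<close>)
  moreover have "continuous_on {t..T} \<omega>" using t by (auto intro: continuous_on_subset[OF \<omega>_cont])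
  moreover have "AE \<tau> in lebesgue_on {t..\<theta>}. (\<omega> has_real_derivative a \<tau> + v \<tau> \<bullet> caputo_derivative \<alpha> x \<tau>) (at \<tau>)"
  proof -
    \<comment> \<open>Adjoining \<open>t\<close>, together with \<open>\<theta> < T\<close>, places
      the remaining points in the open interval where a two-sided derivative can be taken.\<close>
    define N where "N = insert t {\<tau> \<in> {0<..<T}. \<not> ((\<lambda>u. integral {0..u} g) has_vector_derivative g \<tau>) (at \<tau>)}"
    have "negligible N"
      unfolding N_def negligible_insert by (rule negligible_not_has_vector_derivative_integral[OF g(1)])
    then have "AE \<tau> in lebesgue. \<tau> \<notin> N" by (simp add: negligible_iff_null_sets AE_not_in)
    moreover have "(\<omega> has_real_derivative a \<tau> + v \<tau> \<bullet> caputo_derivative \<alpha> x \<tau>) (at \<tau>)"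
      if "\<tau> \<notin> N" "\<tau> \<in> {t..\<theta>}" for \<tau>
    proof -
      have \<tau>: "\<tau> \<in> {t<..<T}" "\<tau> \<in> {0<..<T}" using that t assms(7) by (auto simp: N_def)
      then have "((\<lambda>u. integral {0..u} g) has_vector_derivative g \<tau>) (at \<tau>)" using that by (auto simp: N_def)
      \<comment> \<open>\<open>J\<close> is known to be the integral of \<open>g\<close> only on
        \<open>{0..T}\<close>; the derivative is transferred on its interior.\<close>
      then have J': "(J has_vector_derivative g \<tau>) (at \<tau>)"
        by (rule has_vector_derivative_transform_within_open[OF _ open_greaterThanLessThan \<tau>(2)]) (simp add: J_eq)
      then have "caputo_derivative \<alpha> x \<tau> = g \<tau>"
        unfolding caputo_derivative_def J_def by (rule vector_derivative_at)
      moreover have "(\<omega> has_real_derivative a \<tau> + v \<tau> \<bullet> g \<tau>) (at \<tau>)"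
      proof (rule chain_has_real_derivative[OF _ _ _ _ _ \<tau>(1) J'])
        show "continuous_on {t<..<T} \<omega>" "continuous_on {t<..<T} a" "continuous_on {t<..<T} v"
          using t by (auto intro: continuous_on_subset[OF \<omega>_cont] continuous_on_subset[OF a_cont]
            continuous_on_subset[OF v_cont])
        show "M-lipschitz_on {t<..<T} J" using t by (auto intro: lipschitz_on_subset[OF J_lip])
      qed (use t in \<open>auto intro!: incr\<close>)
      ultimately show ?thesis by simp
    qed
    ultimately show ?thesis by (subst AE_restrict_space_iff) (auto elim: eventually_mono)
  qed
  ultimately show ?thesis by (simp add: Let_def \<omega>_def a_def v_def pos_def)
qed

end
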